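(* Consider a single switching curve, either $y=x^2$ or $y=-x^2$, with the corresponding Melnikov function $M$ described in the context, and let $H(n)$ be the maximum, over all real coefficient choices (polynomials of degree at most $n$) with $M\not\equiv0$, of the number of zeros of $M$ in $(0,+\infty)$ counted with multiplicity. Then $H(1)=3$ (at most $3$ zeros for $n=1$, and $3$ zeros are attained for suitable coefficients), and for every $n\ge 2$, $H(n)\le 2n+5\left[\tfrac{n-1}{2}\right]+4$.
   Context: Fix $n\ge1$ and real polynomials $f_1,g_1,f_2,g_2$ in $(x,y)$ of degree at most $n$ with arbitrary real coefficients. For $h>0$ let $u=\sqrt{(\sqrt{1+4h}-1)/2}$ (so $u>0$, $u^4+u^2=h$), and let $\Gamma_h$ be the circle $x^2+y^2=h$, traversed clockwise (orbits of $\dot x=y,\dot y=-x$). Case $y=x^2$: the system is $\dot x=y+\varepsilon f_1$, $\dot y=-x+\varepsilon g_1$ for $y<x^2$ and $\dot x=y+\varepsilon f_2$, $\dot y=-x+\varepsilon g_2$ for $y>x^2$; with $A=(u,u^2)$, $D=(-u,u^2)$, let $\widehat{AD}$ be the clockwise arc of $\Gamma_h$ from $A$ to $D$ through $(\sqrt h,0),(0,-\sqrt h),(-\sqrt h,0)$ and $\widehat{DA}$ the clockwise arc from $D$ to $A$ through $(0,\sqrt h)$; then $M(h)=\int_{\widehat{AD}}g_1dx-f_1dy+\int_{\widehat{DA}}g_2dx-f_2dy$. Case $y=-x^2$: the system uses $(f_1,g_1)$ for $y>-x^2$ and $(f_2,g_2)$ for $y<-x^2$; with $B=(u,-u^2)$,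 $C=(-u,-u^2)$, let $\widehat{CB}$ be the clockwise arc from $C$ to $B$ through $(-\sqrt h,0),(0,\sqrt h),(\sqrt h,0)$ and $\widehat{BC}$ the clockwise arc from $B$ to $C$ through $(0,-\sqrt h)$; then $M(h)=\int_{\widehat{CB}}g_1dx-f_1dy+\int_{\widehat{BC}}g_2dx-f_2dy$. $[p]$ is the integer part of $p$. *)

theory Defs
  imports "HOL-Analysis.Analysis" "HOL-Library.Extended_Nat"
begin

definition poly2 :: "nat \<Rightarrow> (nat \<Rightarrow> nat \<Rightarrow> real) \<Rightarrow> real \<Rightarrow> real \<Rightarrow> real" where
  "poly2 n a x y = (\<Sum>i\<le>n. \<Sum>j\<le>n - i. a i j * x ^ i * y ^ j)"

definition uu :: "real \<Rightarrow> real" where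
  "uu h = sqrt ((sqrt (1 + 4 * h) - 1) / 2)"

text \<open>Parametrisation of the circle x^2+y^2=h traversed clockwise:
  (x,y) = (sqrt h sin t, sqrt h cos t), t increasing. The point (u,u^2)
  corresponds to the angle thA h.\<close>
definition thA :: "real \<Rightarrow> real" where
  "thA h = arcsin (uu h / sqrt h)"

text \<open>Line integral of g dx - f dy along the clockwise arc of radius r
  from angle al to angle be.\<close>
definition arc_int :: "(real \<Rightarrow> real \<Rightarrow> real) \<Rightarrow> (real \<Rightarrow> real \<Rightarrow> real) \<Rightarrow> real \<Rightarrow> real \<Rightarrow> real \<Rightarrow> real" where
  "arc_int f g r al be =
     integral {al..be} (\<lambda>t. g (r * sin t) (r * cos t) * (r * cos t)
                           + f (r * sin t) (r * cos t) * (r * sin t))"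

datatype curve = Parab | NegParab

definition melnikov :: "curve \<Rightarrow> nat \<Rightarrow> (nat \<Rightarrow> nat \<Rightarrow> real) \<Rightarrow> (nat \<Rightarrow> nat \<Rightarrow> real)
    \<Rightarrow> (nat \<Rightarrow> nat \<Rightarrow> real) \<Rightarrow> (nat \<Rightarrow> nat \<Rightarrow> real) \<Rightarrow> real \<Rightarrow> real" where
  "melnikov c n a1 b1 a2 b2 h =
    (let f1 = poly2 n a1; g1 = poly2 n b1; f2 = poly2 n a2; g2 = poly2 n b2;
         r = sqrt h; th = thA h in
     case c of
       Parab \<Rightarrow> arc_int f1 g1 r th (2 * pi - th) + arc_int f2 g2 r (2 * pi - th) (2 * pi + th)
     | NegParab \<Rightarrow> arc_int f1 g1 r (pi + th) (3 * pi - th) + arc_int f2 g2 r (pi - th) (pi + th))"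

definition zero_mult :: "(real \<Rightarrow> real) \<Rightarrow> real \<Rightarrow> enat" where
  "zero_mult M h0 = (if \<forall>k. (deriv ^^ k) M h0 = 0 then \<infinity>
                     else enat (LEAST k. (deriv ^^ k) M h0 \<noteq> 0))"

definition num_zeros :: "(real \<Rightarrow> real) \<Rightarrow> enat" where
  "num_zeros M = (let Z = {h. 0 < h \<and> M h = 0} in
                  if finite Z then (\<Sum>h\<in>Z. zero_mult M h) else \<infinity>)"

definition HH :: "curve \<Rightarrow> nat \<Rightarrow> enat" where
  "HH c n = Sup {num_zeros (melnikov c n a1 b1 a2 b2) | a1 b1 a2 b2.
                  \<exists>h>0. melnikov c n a1 b1 a2 b2 h \<noteq> 0}"

end

theory Submission
  imports Defs
begin

text \<open>
  Put \<open>u = uu h\<close>, \<open>w = u\<^sup>2\<close> and let \<open>\<theta>\<close> be the angle of the switching point. Reducing the integrals of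
  monomials over the two arcs gives \<open>M(h) = h (p(h) + q(h) \<theta>) + u R(w)\<close> with polynomials p, q of degree
  at most \<open>N = [(n-1)/2]\<close> and R of degree at most n. Since \<open>d\<theta>/dh\<close> is u times a rational function of w,
  differentiating \<open>M/h\<close> \<open>N + 1\<close> times with respect to h removes p and every occurrence of \<open>\<theta>\<close>; what
  remains is u times a rational function of w whose numerator has degree at most \<open>n + 2N + 1\<close>. Rolle's
  theorem, counted with multiplicities, bounds the number of zeros of M by \<open>n + 3N + 2\<close>.
\<close>

section \<open>Rolle's theorem with multiplicities\<close>

text \<open>Everything is algebraic in w: h = w(1 + w), sqrt(1 + 4h) = 1 + 2w and dw/dh = 1/(1 +
  2w), while u = w^(1/2) stays a common factor under differentiation. Dividing M by h beforehand
  saves one derivative, since p and q have lower degree than h p and h q. The difficulty is the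
  degree count. Taking d/dw of the algebraic part adds the factors w, 1 + w and 1 + 2w to the
  denominator, so the numerator gains 3 - 1 = 2 degrees; dw/dh only enlarges the denominator. With
  one zero lost to Rolle, a step costs 3. The first step costs 2, because no power of 1 + 2w is in
  the denominator yet. The total n + 2 + 3N is below the claimed bound for every n >= 2 and equals 3
  for n = 1, so one estimate serves both claims. For sharpness at n = 1, the coefficients are chosen
  so that \<theta> cancels and M becomes a quartic in u, and u takes every positive value.\<close>

primrec diff_times :: "real set \<Rightarrow> nat \<Rightarrow> (real \<Rightarrow> real) \<Rightarrow> bool" where
  "diff_times S 0 f \<longleftrightarrow> True"
| "diff_times S (Suc k) f \<longleftrightarrow> (\<forall>x\<in>S. f differentiable (at x)) \<and> diff_times S k (deriv f)"

text \<open>Multiplicities are read off \<open>deriv ^^ k\<close>, and \<open>deriv\<close> is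
  total, so its values mean something only where differentiability is known. Hence
  \<open>diff_times\<close> recurses along \<open>deriv\<close> itself.\<close>

definition smooth :: "real set \<Rightarrow> (real \<Rightarrow> real) \<Rightarrow> bool" where
  "smooth S f \<longleftrightarrow> (\<forall>k. diff_times S k f)"

lemma deriv_cong_open:
  assumes "open S" "\<And>x. x \<in> S \<Longrightarrow> f x = g x" "x \<in> S"
  shows "deriv f x = deriv (g :: real \<Rightarrow> real) x"
  by (rule deriv_cong_ev) (use assms in \<open>auto simp: eventually_nhds\<close>)

lemma higher_deriv_cong_open:
  fixes f g :: "real \<Rightarrow> real"
  assumes "open S" "\<And>x. x \<in> S \<Longrightarrow> f x = g x" "x \<in> S"
  shows "(deriv ^^ k) f x = (deriv ^^ k) g x"
  using assms(3)
proof (induction k arbitrary: x)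
  case (Suc k)
  show ?case
    using deriv_cong_open[OF assms(1) Suc.IH Suc.prems] by simp
qed (use assms in simp)

lemma diff_times_cong:
  assumes "open S" "\<And>x. x \<in> S \<Longrightarrow> f x = g x" "diff_times S k f"
  shows "diff_times S k g"
  using assms(2,3)
proof (induction k arbitrary: f g)
  case (Suc k)
  have "g differentiable (at x)" if x: "x \<in> S" for x
  proof -
    have "(f has_real_derivative deriv f x) (at x)"
      using Suc.prems x by (simp add: DERIV_deriv_iff_real_differentiable)
    then have "(g has_real_derivative deriv f x) (at x)"
      by (rule has_field_derivative_transform_within_open[OF _ assms(1) x]) (use Suc.prems in auto)
    then show ?thesis using real_differentiable_def by blast
  qed
  moreover have "diff_times S k (deriv g)"
    by (rule Suc.IH[of "deriv f"])
      (use Suc.prems deriv_cong_open[OF assms(1), of f g] in auto)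
  ultimately show ?case by simp
qed simp

lemma diff_times_SucI:
  assumes "open S" "\<And>x. x \<in> S \<Longrightarrow> (f has_real_derivative f' x) (at x)" "diff_times S k f'"
  shows "diff_times S (Suc k) f"
proof -
  have "diff_times S k (deriv f)"
    by (rule diff_times_cong[OF assms(1) _ assms(3)])
      (use assms(2) DERIV_imp_deriv in fastforce)
  moreover have "\<forall>x\<in>S. f differentiable (at x)"
    using assms(2) real_differentiable_def by blast
  ultimately show ?thesis by simp
qed

lemma diff_times_SucD:
  assumes "diff_times S (Suc k) f" "x \<in> S"
  shows "(f has_real_derivative deriv f x) (at x)"
  using assms by (simp add: DERIV_deriv_iff_real_differentiable)

lemma diff_times_Suc_imp: "diff_times S (Suc k) f \<Longrightarrow> diff_times S k f"
  by (induction k arbitrary: f) auto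

lemma diff_times_const: "diff_times S k (\<lambda>x. c)"
proof (induction k arbitrary: c)
  case (Suc k)
  have "deriv (\<lambda>x::real. c) = (\<lambda>x. 0)" by auto
  with Suc[of 0] show ?case by simp
qed simp

lemma diff_times_ident: "diff_times S k (\<lambda>x. x)"
proof (cases k)
  case (Suc k')
  have "deriv (\<lambda>x::real. x) = (\<lambda>x. 1)" by auto
  with diff_times_const show ?thesis by (simp add: Suc)
qed simp

lemma diff_times_add:
  assumes "open S" "diff_times S k f" "diff_times S k g"
  shows "diff_times S k (\<lambda>x. f x + g x)"
  using assms(2,3)
proof (induction k arbitrary: f g)
  case (Suc k)
  show ?case
    by (rule diff_times_SucI[OF assms(1), where f' = "\<lambda>x. deriv f x + deriv g x"])
      (use Suc in \<open>auto intro!: DERIV_add diff_times_SucD[of S k]\<close>)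
qed simp

lemma diff_times_mult:
  assumes "open S" "diff_times S k f" "diff_times S k g"
  shows "diff_times S k (\<lambda>x. f x * g x)"
  using assms(2,3)
proof (induction k arbitrary: f g)
  case (Suc k)
  show ?case
  proof (rule diff_times_SucI[OF assms(1)])
    show "((\<lambda>x. f x * g x) has_real_derivative deriv f x * g x + f x * deriv g x) (at x)"
      if "x \<in> S" for x
      using DERIV_mult[OF diff_times_SucD[OF Suc.prems(1) that] diff_times_SucD[OF Suc.prems(2) that]]
      by (simp add: algebra_simps)
    show "diff_times S k (\<lambda>x. deriv f x * g x + f x * deriv g x)"
      using Suc.prems diff_times_Suc_imp by (intro diff_times_add assms(1) Suc.IH) auto
  qed
qed simp

text \<open>Induction closes because the derivative of 1/f involves only f' and 1/f again, each of
  one order less.\<close>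

lemma diff_times_inverse:
  assumes "open S" "diff_times S k f" "\<And>x. x \<in> S \<Longrightarrow> f x \<noteq> 0"
  shows "diff_times S k (\<lambda>x. inverse (f x))"
  using assms(2)
proof (induction k)
  case (Suc k)
  show ?case
  proof (rule diff_times_SucI[OF assms(1)])
    show "((\<lambda>x. inverse (f x)) has_real_derivative
        (-1) * (deriv f x * (inverse (f x) * inverse (f x)))) (at x)" if "x \<in> S" for x
      using DERIV_inverse'[OF diff_times_SucD[OF Suc.prems that] assms(3)[OF that]]
      by (simp add: algebra_simps)
    have IH: "diff_times S k (\<lambda>x. inverse (f x))"
      using Suc diff_times_Suc_imp by blast
    show "diff_times S k (\<lambda>x. (-1) * (deriv f x * (inverse (f x) * inverse (f x))))"
      using Suc.prems by (intro diff_times_mult assms(1) IH diff_times_const) auto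
  qed
qed simp

lemma smooth_const [intro]: "smooth S (\<lambda>x. c)"
  and smooth_ident [intro]: "smooth S (\<lambda>x. x)"
  by (auto simp: smooth_def diff_times_const diff_times_ident)

lemma smooth_add [intro]: "open S \<Longrightarrow> smooth S f \<Longrightarrow> smooth S g \<Longrightarrow> smooth S (\<lambda>x. f x + g x)"
  by (auto simp: smooth_def intro: diff_times_add)

lemma smooth_mult [intro]: "open S \<Longrightarrow> smooth S f \<Longrightarrow> smooth S g \<Longrightarrow> smooth S (\<lambda>x. f x * g x)"
  by (auto simp: smooth_def intro: diff_times_mult)

lemma smooth_inverse [intro]:
  "open S \<Longrightarrow> smooth S f \<Longrightarrow> (\<And>x. x \<in> S \<Longrightarrow> f x \<noteq> 0) \<Longrightarrow> smooth S (\<lambda>x. inverse (f x))"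
  by (auto simp: smooth_def intro: diff_times_inverse)

lemma smooth_divide [intro]:
  "open S \<Longrightarrow> smooth S f \<Longrightarrow> smooth S g \<Longrightarrow> (\<And>x. x \<in> S \<Longrightarrow> g x \<noteq> 0) \<Longrightarrow> smooth S (\<lambda>x. f x / g x)"
  unfolding divide_inverse by (intro smooth_mult smooth_inverse)

lemma smooth_power [intro]: "open S \<Longrightarrow> smooth S f \<Longrightarrow> smooth S (\<lambda>x. f x ^ k)"
  by (induction k) auto

lemma smooth_poly [intro]: "open S \<Longrightarrow> smooth S f \<Longrightarrow> smooth S (\<lambda>x. poly p (f x))"
  by (induction p) auto

lemma smooth_deriv: "smooth S f \<Longrightarrow> smooth S (deriv f)"
  by (metis smooth_def diff_times.simps(2))

lemma smooth_has_deriv: "smooth S f \<Longrightarrow> x \<in> S \<Longrightarrow> (f has_real_derivative deriv f x) (at x)"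
  using diff_times_SucD smooth_def by blast

lemma smooth_of_deriv:
  assumes "open S" "\<And>x. x \<in> S \<Longrightarrow> (f has_real_derivative f' x) (at x)" "smooth S f'"
  shows "smooth S f"
  using assms diff_times_SucI[OF assms(1,2)] diff_times_Suc_imp unfolding smooth_def by blast

lemma deriv_add_smooth:
  "smooth S f \<Longrightarrow> smooth S g \<Longrightarrow> x \<in> S \<Longrightarrow> deriv (\<lambda>x. f x + g x) x = deriv f x + deriv g x"
  by (intro DERIV_imp_deriv DERIV_add smooth_has_deriv)

lemma deriv_mult_smooth:
  assumes "smooth S f" "smooth S g" "x \<in> S"
  shows "deriv (\<lambda>x. f x * g x) x = deriv f x * g x + f x * deriv g x"
  using DERIV_mult[OF smooth_has_deriv[OF assms(1,3)] smooth_has_deriv[OF assms(2,3)]]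
  by (simp add: DERIV_imp_deriv algebra_simps)

lemma higher_deriv_add_smooth:
  assumes "open S" "smooth S f" "smooth S g" "x \<in> S"
  shows "(deriv ^^ i) (\<lambda>x. f x + g x) x = (deriv ^^ i) f x + (deriv ^^ i) g x"
  using assms(2,3)
proof (induction i arbitrary: f g)
  case (Suc i)
  have "(deriv ^^ Suc i) (\<lambda>x. f x + g x) x = (deriv ^^ i) (deriv (\<lambda>x. f x + g x)) x"
    by (simp add: funpow_swap1)
  also have "\<dots> = (deriv ^^ i) (\<lambda>x. deriv f x + deriv g x) x"
    by (rule higher_deriv_cong_open[OF assms(1) _ assms(4)])
      (use deriv_add_smooth Suc.prems in blast)
  also have "\<dots> = (deriv ^^ i) (deriv f) x + (deriv ^^ i) (deriv g) x"
    using Suc by (intro Suc.IH smooth_deriv)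
  finally show ?case by (simp add: funpow_swap1)
qed simp

text \<open>In f'g + fg' both products have a first or second factor, f' or f, vanishing to order at
  least k - 1, so induction on k avoids the full Leibniz formula.\<close>

lemma higher_deriv_mult_vanish:
  assumes "open S" "smooth S f" "smooth S g" "x \<in> S" "\<And>i. i < k \<Longrightarrow> (deriv ^^ i) f x = 0" "j < k"
  shows "(deriv ^^ j) (\<lambda>x. f x * g x) x = 0"
  using assms(2,3,5,6)
proof (induction k arbitrary: f g j)
  case (Suc k)
  show ?case
  proof (cases j)
    case 0
    then show ?thesis using Suc.prems(3)[of 0] by simp
  next
    case (Suc i)
    have ik: "i < k" using Suc Suc.prems by simp
    have "(deriv ^^ j) (\<lambda>x. f x * g x) x = (deriv ^^ i) (deriv (\<lambda>x. f x * g x)) x"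
      by (simp add: funpow_swap1 Suc)
    also have "\<dots> = (deriv ^^ i) (\<lambda>x. deriv f x * g x + f x * deriv g x) x"
      by (rule higher_deriv_cong_open[OF assms(1) _ assms(4)])
        (use deriv_mult_smooth Suc.prems(1,2) in blast)
    also have "\<dots> = (deriv ^^ i) (\<lambda>x. deriv f x * g x) x + (deriv ^^ i) (\<lambda>x. f x * deriv g x) x"
      using assms(1,4) Suc.prems(1,2) by (intro higher_deriv_add_smooth smooth_mult smooth_deriv)
    also have "(deriv ^^ i) (\<lambda>x. deriv f x * g x) x = 0"
    proof (rule Suc.IH)
      show "(deriv ^^ l) (deriv f) x = 0" if "l < k" for l
        using Suc.prems(3)[of "Suc l"] that by (simp add: funpow_swap1)
    qed (use Suc.prems ik smooth_deriv in auto)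
    also have "(deriv ^^ i) (\<lambda>x. f x * deriv g x) x = 0"
      by (rule Suc.IH) (use Suc.prems ik smooth_deriv in auto)
    finally show ?thesis by simp
  qed
qed simp

section \<open>Counting zeros with multiplicity\<close>

text \<open>The count runs over finite sets with prescribed lower bounds \<open>k x\<close> for the
  multiplicity. Neither finiteness of the zero set nor existence of exact multiplicities has to be
  known beforehand; both follow later.\<close>

definition zeros_le :: "real set \<Rightarrow> (real \<Rightarrow> real) \<Rightarrow> nat \<Rightarrow> bool" where
  "zeros_le S f m \<longleftrightarrow> (\<forall>A k. finite A \<longrightarrow> A \<subseteq> S \<longrightarrow>
     (\<forall>x\<in>A. \<forall>i<k x. (deriv ^^ i) f x = 0) \<longrightarrow> sum k A \<le> m)"

lemma zeros_leD:
  assumes "zeros_le S f m" "finite A" "A \<subseteq> S"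
    "\<And>x i. x \<in> A \<Longrightarrow> i < k x \<Longrightarrow> (deriv ^^ i) f x = 0"
  shows "sum k A \<le> m"
  using assms unfolding zeros_le_def by blast

lemma zeros_le_mono: "zeros_le S f m \<Longrightarrow> m \<le> m' \<Longrightarrow> zeros_le S f m'"
  unfolding zeros_le_def by (meson le_trans)

lemma zeros_le_cong:
  assumes "open S" "\<And>x. x \<in> S \<Longrightarrow> f x = g x" "zeros_le S f m"
  shows "zeros_le S g m"
  unfolding zeros_le_def
proof (intro allI impI)
  fix A :: "real set" and k
  assume A: "finite A" "A \<subseteq> S" "\<forall>x\<in>A. \<forall>i<k x. (deriv ^^ i) g x = 0"
  have "(deriv ^^ i) f x = 0" if "x \<in> A" "i < k x" for x i
    using A that higher_deriv_cong_open[OF assms(1,2), where x = x and k = i] by auto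
  with A assms(3) show "sum k A \<le> m" by (intro zeros_leD)
qed

lemma zeros_le_nonzero:
  assumes "\<And>x. x \<in> S \<Longrightarrow> f x \<noteq> 0"
  shows "zeros_le S f 0"
  unfolding zeros_le_def
proof (intro allI impI)
  fix A :: "real set" and k :: "real \<Rightarrow> nat"
  assume A: "finite A" "A \<subseteq> S" "\<forall>x\<in>A. \<forall>i<k x. (deriv ^^ i) f x = 0"
  have "k x = 0" if "x \<in> A" for x
  proof (rule ccontr)
    assume "k x \<noteq> 0"
    then have "(deriv ^^ 0) f x = 0" using A(3) that by blast
    then show False using assms[of x] A(2) that by auto
  qed
  then show "sum k A \<le> 0" by simp
qed

text \<open>A smooth factor cannot lower a multiplicity. It serves to strip nowhere vanishing
  factors such as u, h and denominators.\<close>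

lemma zeros_le_factor:
  assumes "open S" "smooth S f" "smooth S g" "zeros_le S (\<lambda>x. f x * g x) m"
  shows "zeros_le S f m"
  unfolding zeros_le_def
proof (intro allI impI)
  fix A :: "real set" and k
  assume A: "finite A" "A \<subseteq> S" "\<forall>x\<in>A. \<forall>i<k x. (deriv ^^ i) f x = 0"
  show "sum k A \<le> m"
  proof (rule zeros_leD[OF assms(4) A(1,2)])
    show "(deriv ^^ i) (\<lambda>x. f x * g x) x = 0" if "x \<in> A" "i < k x" for x i
      using A that by (intro higher_deriv_mult_vanish[OF assms(1-3), of _ "k x"]) auto
  qed
qed

text \<open>Points are added in increasing order. The clause that each zero of f' lies left of some
  point of A makes the zero found in the last gap distinct from all earlier ones.\<close>

lemma Rolle_finite_set:
  fixes f :: "real \<Rightarrow> real"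
  assumes S: "is_interval S" and f: "\<And>x. x \<in> S \<Longrightarrow> (f has_real_derivative f' x) (at x)"
    and A: "finite A" "A \<subseteq> S" "\<And>x. x \<in> A \<Longrightarrow> f x = 0"
  shows "\<exists>B. finite B \<and> B \<subseteq> S - A \<and> (\<forall>x\<in>B. f' x = 0 \<and> (\<exists>a\<in>A. x < a)) \<and> card B = card A - 1"
  using A
proof (induction A rule: finite_linorder_max_induct)
  case (insert b A)
  show ?case
  proof (cases "A = {}")
    case False
    obtain B where B: "finite B" "B \<subseteq> S - A" "\<forall>x\<in>B. f' x = 0 \<and> (\<exists>a\<in>A. x < a)"
      "card B = card A - 1"
    proof -
      have "A \<subseteq> S" "\<And>x. x \<in> A \<Longrightarrow> f x = 0" using insert.prems by auto
      with insert.IH that show thesis by blast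
    qed
    define a where "a = Max A"
    have a: "a \<in> A" "\<And>x. x \<in> A \<Longrightarrow> x \<le> a" "a < b"
      using insert.hyps False by (auto simp: a_def)
    have seg: "x \<in> S" if "a \<le> x" "x \<le> b" for x
      using mem_is_interval_1_I[OF S, of a b x] insert.prems a that by auto
    have "\<exists>z>a. z < b \<and> f b - f a = (b - a) * f' z"
      by (rule MVT2[OF \<open>a < b\<close>]) (use f seg in auto)
    then have "\<exists>z>a. z < b \<and> f' z = 0"
      using insert.prems(2) a by auto
    then obtain z where z: "a < z" "z < b" "f' z = 0" by blast
    have Ba: "x < a" if "x \<in> B" for x
    proof -
      obtain y where "y \<in> A" "x < y" using B(3) \<open>x \<in> B\<close> by blast
      with a(2)[of y] show ?thesis by simp
    qed
    have zB: "z \<notin> B" using Ba[of z] z(1) by auto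
    have bB: "b \<notin> B" using Ba[of b] a(3) by auto
    have zA: "z \<notin> insert b A" using a(2)[of z] z(1,2) by auto
    have zS: "z \<in> S" using seg[of z] z by simp
    show ?thesis
    proof (intro exI[of _ "insert z B"] conjI)
      show "insert z B \<subseteq> S - insert b A" using B(2) zA zS bB by blast
      show "\<forall>x\<in>insert z B. f' x = 0 \<and> (\<exists>a\<in>insert b A. x < a)" using B(3) z(2,3) by auto
      show "card (insert z B) = card (insert b A) - 1"
        using B(1,4) zB insert.hyps False by (auto simp: card_gt_0_iff)
    qed (use B(1) in simp)
  next
    case True
    then show ?thesis by (intro exI[of _ "{}"]) simp
  qed
qed simp

text \<open>A zero of order k leaves one of order k - 1 for the derivative, and the gaps supply card
  A - 1 further zeros: altogether only one is lost.\<close>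

lemma zeros_le_Rolle:
  assumes S: "is_interval S" and f: "\<And>x. x \<in> S \<Longrightarrow> (f has_real_derivative deriv f x) (at x)"
    and m: "zeros_le S (deriv f) m"
  shows "zeros_le S f (Suc m)"
  unfolding zeros_le_def
proof (intro allI impI)
  fix A0 :: "real set" and k :: "real \<Rightarrow> nat"
  assume A0: "finite A0" "A0 \<subseteq> S" "\<forall>x\<in>A0. \<forall>i<k x. (deriv ^^ i) f x = 0"
  \<comment> \<open>Points of prescribed multiplicity 0 need not be zeros, and truncated subtraction
    would spoil \<open>k x - 1\<close> there.\<close>
  define A where "A = {x \<in> A0. k x > 0}"
  have A: "finite A" "A \<subseteq> S" using A0 by (auto simp: A_def)
  have fA: "f x = 0" if "x \<in> A" for x
  proof -
    have "(deriv ^^ 0) f x = 0" using A0 that unfolding A_def by blast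
    then show ?thesis by simp
  qed
  obtain B where B: "finite B" "B \<subseteq> S - A" "\<forall>x\<in>B. deriv f x = 0" "card B = card A - 1"
    using Rolle_finite_set[OF S f A fA] by auto
  define k' where "k' x = (if x \<in> A then k x - 1 else 1)" for x
  have "sum k' (A \<union> B) \<le> m"
  proof -
    have "(deriv ^^ i) (deriv f) x = 0" if x: "x \<in> A \<union> B" and i: "i < k' x" for x i
    proof (cases "x \<in> A")
      case True
      then have "(deriv ^^ Suc i) f x = 0" using A0 i by (auto simp: A_def k'_def simp del: funpow.simps)
      then show ?thesis by (simp add: funpow_swap1)
    next
      case False
      with B x i show ?thesis by (auto simp: k'_def)
    qed
    moreover have "finite (A \<union> B)" "A \<union> B \<subseteq> S" using A B by auto
    ultimately show ?thesis by (intro zeros_leD[OF m])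
  qed
  also have "sum k' (A \<union> B) = (\<Sum>x\<in>A. k x - 1) + card B"
  proof -
    have "sum k' (A \<union> B) = sum k' A + sum k' B"
      using A B by (intro sum.union_disjoint) auto
    moreover have "sum k' B = card B"
      using B by (subst card_eq_sum, intro sum.cong) (auto simp: k'_def)
    ultimately show ?thesis by (simp add: k'_def)
  qed
  finally have *: "(\<Sum>x\<in>A. k x - 1) + card B \<le> m" .
  have "sum k A0 = sum k A"
    using A0 by (intro sum.mono_neutral_right) (auto simp: A_def)
  also have "\<dots> = (\<Sum>x\<in>A. (k x - 1) + 1)"
    by (intro sum.cong) (auto simp: A_def)
  also have "\<dots> = (\<Sum>x\<in>A. k x - 1) + card A"
    by (subst sum.distrib) simp
  finally show "sum k A0 \<le> Suc m" using * B(4) by linarith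
qed

text \<open>If f' vanishes identically, no bound for f' can be expected, but then f is a nonzero
  constant. So the bound is asked only for nontrivial f', which lets it come from an induction
  hypothesis with the same proviso.\<close>

lemma zeros_le_of_deriv:
  assumes S: "open S" "is_interval S" and f: "smooth S f"
    and f': "\<And>x. x \<in> S \<Longrightarrow> (f has_real_derivative f' x) (at x)"
    and nz: "\<exists>x\<in>S. f x \<noteq> 0"
    and m: "\<exists>x\<in>S. f' x \<noteq> 0 \<Longrightarrow> zeros_le S f' m"
  shows "zeros_le S f (Suc m)"
proof (cases "\<exists>x\<in>S. f' x \<noteq> 0")
  case True
  have "zeros_le S (deriv f) m"
    by (rule zeros_le_cong[OF S(1) _ m[OF True]]) (use f' DERIV_imp_deriv in fastforce)
  then show ?thesis using zeros_le_Rolle S smooth_has_deriv[OF f] by blast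
next
  case False
  have "\<exists>c. \<forall>x\<in>S. f x = c"
    by (rule has_field_derivative_zero_constant[OF is_interval_convex[OF S(2)]])
      (use f' False in \<open>auto intro: has_field_derivative_at_within\<close>)
  then have "zeros_le S f 0" using nz by (intro zeros_le_nonzero) metis
  then show ?thesis using zeros_le_mono by blast
qed

text \<open>Rolle is iterated on the degree of p, the factor w' being removed each time. This avoids
  transporting multiplicities through the composition.\<close>

lemma zeros_le_poly_comp:
  assumes S: "open S" "is_interval S" and w: "smooth S w"
    and w': "\<And>x. x \<in> S \<Longrightarrow> (w has_real_derivative w' x) (at x)" "\<And>x. x \<in> S \<Longrightarrow> w' x \<noteq> 0"
    and p: "p \<noteq> 0"
  shows "zeros_le S (\<lambda>x. poly p (w x)) (degree p)"
  using p
proof (induction "degree p" arbitrary: p)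
  case 0
  then obtain c where "p = [:c:]" "c \<noteq> 0" by (metis degree_eq_zeroE pCons_0_0)
  then show ?case by (auto intro: zeros_le_nonzero)
next
  case (Suc d)
  have dw: "smooth S (deriv w)" using w smooth_deriv by blast
  have w'eq: "deriv w x = w' x" if "x \<in> S" for x using w'(1)[OF that] DERIV_imp_deriv by blast
  have p': "pderiv p \<noteq> 0" using Suc.hyps by (simp add: pderiv_eq_0_iff)
  have "zeros_le S (\<lambda>x. poly (pderiv p) (w x)) d"
    using Suc.hyps(1)[OF _ p'] degree_pderiv[of p] by (simp flip: Suc.hyps(2))
  then have "zeros_le S (\<lambda>x. (poly (pderiv p) (w x) * deriv w x) * inverse (deriv w x)) d"
    by (rule zeros_le_cong[OF S(1), rotated]) (use w'eq w' in auto)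
  then have d: "zeros_le S (\<lambda>x. poly (pderiv p) (w x) * deriv w x) d"
    by (rule zeros_le_factor[OF S(1), rotated 2])
      (use S w dw w'eq w' in \<open>auto intro!: smooth_mult smooth_inverse smooth_poly\<close>)
  have D: "((\<lambda>x. poly p (w x)) has_real_derivative poly (pderiv p) (w x) * deriv w x) (at x)"
    if "x \<in> S" for x
    using DERIV_chain2[OF poly_DERIV smooth_has_deriv[OF w that]] by simp
  have "zeros_le S (deriv (\<lambda>x. poly p (w x))) d"
    by (rule zeros_le_cong[OF S(1) _ d]) (use D DERIV_imp_deriv in fastforce)
  moreover have "((\<lambda>x. poly p (w x)) has_real_derivative deriv (\<lambda>x. poly p (w x)) x) (at x)"
    if "x \<in> S" for x
    using S w that by (intro smooth_has_deriv smooth_poly)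
  ultimately show ?case
    unfolding Suc.hyps(2)[symmetric] by (intro zeros_le_Rolle[OF S(2)])
qed

text \<open>Three choices of k: constant 1 on m + 1 zeros gives finiteness, m + 1 at a single zero
  gives finite order, and the exact orders give the bound.\<close>

lemma num_zeros_le:
  assumes "zeros_le {0<..} f m"
  shows "num_zeros f \<le> enat m"
proof -
  define Z where "Z = {h. 0 < h \<and> f h = 0}"
  have fin: "finite Z"
  proof (rule ccontr)
    assume "infinite Z"
    then obtain A where A: "finite A" "card A = Suc m" "A \<subseteq> Z"
      using infinite_arbitrarily_large by blast
    then have "sum (\<lambda>_. 1) A \<le> m"
      by (intro zeros_leD[OF assms]) (auto simp: Z_def)
    with A show False by simp
  qed
  have "\<exists>k. (deriv ^^ k) f x \<noteq> 0" if "x \<in> Z" for x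
  proof (rule ccontr)
    assume *: "\<nexists>k. (deriv ^^ k) f x \<noteq> 0"
    then have "sum (\<lambda>_. Suc m) {x} \<le> m"
      using that by (intro zeros_leD[OF assms]) (auto simp: Z_def)
    then show False by simp
  qed
  then have zm: "zero_mult f x = enat (LEAST k. (deriv ^^ k) f x \<noteq> 0)" if "x \<in> Z" for x
    using that unfolding zero_mult_def by auto
  have "(\<Sum>x\<in>Z. LEAST k. (deriv ^^ k) f x \<noteq> 0) \<le> m"
    using fin by (intro zeros_leD[OF assms]) (auto simp: Z_def dest: not_less_Least)
  moreover have "(\<Sum>x\<in>Z. zero_mult f x) = enat (\<Sum>x\<in>Z. LEAST k. (deriv ^^ k) f x \<noteq> 0)"
    using zm fin by (simp add: of_nat_eq_enat[symmetric])
  ultimately show ?thesis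
    using fin unfolding num_zeros_def Let_def Z_def[symmetric] by simp
qed

lemma num_zeros_ge_card:
  assumes "finite A" "\<And>x. x \<in> A \<Longrightarrow> 0 < x \<and> f x = 0"
  shows "enat (card A) \<le> num_zeros f"
proof (cases "finite {h. 0 < h \<and> f h = 0}")
  case True
  have ge1: "1 \<le> zero_mult f x" if "f x = 0" for x
  proof (cases "\<forall>k. (deriv ^^ k) f x = 0")
    case False
    then have "(deriv ^^ (LEAST k. (deriv ^^ k) f x \<noteq> 0)) f x \<noteq> 0"
      by (intro LeastI_ex[of "\<lambda>k. (deriv ^^ k) f x \<noteq> 0"]) simp
    then have "(LEAST k. (deriv ^^ k) f x \<noteq> 0) \<noteq> 0"
      using that by (metis funpow_0)
    then show ?thesis using False by (simp add: zero_mult_def one_enat_def)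
  qed (simp add: zero_mult_def)
  have "enat (card A) = (\<Sum>x\<in>A. 1)" by (simp add: of_nat_eq_enat)
  also have "\<dots> \<le> (\<Sum>x\<in>A. zero_mult f x)" using assms ge1 by (intro sum_mono) auto
  also have "\<dots> \<le> (\<Sum>x\<in>{h. 0 < h \<and> f h = 0}. zero_mult f x)"
    using assms True by (intro sum_mono2) auto
  finally show ?thesis using True by (simp add: num_zeros_def)
qed (simp add: num_zeros_def)

section \<open>The functions obtained by differentiating the Melnikov function\<close>

lemma uu_sq: "0 < h \<Longrightarrow> (uu h)\<^sup>2 = (sqrt (1 + 4 * h) - 1) / 2"
  by (simp add: uu_def)

lemma uu_pos: "0 < h \<Longrightarrow> 0 < uu h"
  by (simp add: uu_def)

lemma sqrt_uu: "0 < h \<Longrightarrow> sqrt (1 + 4 * h) = 1 + 2 * (uu h)\<^sup>2"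
  using uu_sq[of h] by simp

lemma uu_eq:
  assumes "0 < h"
  shows "(uu h)\<^sup>2 * (1 + (uu h)\<^sup>2) = h"
proof -
  have "(1 + 2 * (uu h)\<^sup>2)\<^sup>2 = 1 + 4 * h"
    using assms by (simp flip: sqrt_uu)
  then show ?thesis by (simp add: power2_eq_square algebra_simps)
qed

text \<open>This allows h to be chosen with a prescribed value of u when the three zeros are
  located.\<close>

lemma uu_inverse:
  assumes "0 < v"
  shows "uu (v\<^sup>2 * (1 + v\<^sup>2)) = v"
proof -
  have "1 + 4 * (v\<^sup>2 * (1 + v\<^sup>2)) = (1 + 2 * v\<^sup>2)\<^sup>2"
    by (simp add: power2_eq_square algebra_simps)
  then have "sqrt (1 + 4 * (v\<^sup>2 * (1 + v\<^sup>2))) = 1 + 2 * v\<^sup>2"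
    by (simp add: real_sqrt_unique)
  with assms show ?thesis by (simp add: uu_def)
qed

lemma uu_has_deriv:
  assumes "0 < h"
  shows "(uu has_real_derivative inverse (2 * uu h * (1 + 2 * (uu h)\<^sup>2))) (at h)"
proof -
  have "((\<lambda>h. (sqrt (1 + 4 * h) - 1) / 2) has_real_derivative inverse (sqrt (1 + 4 * h))) (at h)"
    using assms by (auto intro!: derivative_eq_intros simp: field_simps)
  then have "((\<lambda>h. sqrt ((sqrt (1 + 4 * h) - 1) / 2)) has_real_derivative
      inverse (sqrt ((sqrt (1 + 4 * h) - 1) / 2)) / 2 * inverse (sqrt (1 + 4 * h))) (at h)"
    using assms by (intro DERIV_chain2[where f = sqrt] DERIV_real_sqrt) auto
  then show ?thesis
    unfolding uu_def[symmetric] sqrt_uu[OF assms]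
    by (rule DERIV_cong) (use uu_pos[OF assms] in simp)
qed

lemma one_plus_uu_pos: "0 < 1 + (uu h)\<^sup>2" "0 < 1 + 2 * (uu h)\<^sup>2"
  using zero_le_power2[of "uu h"] by linarith+

lemma uu_sq_has_deriv:
  assumes "0 < h"
  shows "((\<lambda>h. (uu h)\<^sup>2) has_real_derivative inverse (1 + 2 * (uu h)\<^sup>2)) (at h)"
proof -
  have "((\<lambda>h. (uu h)\<^sup>2) has_real_derivative 2 * uu h * inverse (2 * uu h * (1 + 2 * (uu h)\<^sup>2))) (at h)"
    by (auto intro!: derivative_eq_intros uu_has_deriv[OF assms])
  then show ?thesis
    by (rule DERIV_cong) (use uu_pos[OF assms] in \<open>simp add: mult.assoc[symmetric]\<close>)
qed

text \<open>The angle is measured from the positive y-axis, so its tangent at (u, u^2) is x/y =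
  1/u.\<close>

lemma sin_arctan_uu: "0 < h \<Longrightarrow> sqrt h * sin (arctan (inverse (uu h))) = uu h"
  and cos_arctan_uu: "0 < h \<Longrightarrow> sqrt h * cos (arctan (inverse (uu h))) = (uu h)\<^sup>2"
proof -
  assume h: "0 < h"
  let ?u = "uu h"
  have u: "0 < ?u" by (rule uu_pos[OF h])
  have r: "sqrt h = ?u * sqrt (1 + ?u\<^sup>2)"
    by (subst uu_eq[OF h, symmetric]) (use u in \<open>simp add: real_sqrt_mult\<close>)
  have "1 + (inverse ?u)\<^sup>2 = (1 + ?u\<^sup>2) / ?u\<^sup>2"
    using u by (simp add: field_simps)
  then have s: "sqrt (1 + (inverse ?u)\<^sup>2) = sqrt (1 + ?u\<^sup>2) / ?u"
    using u by (simp add: real_sqrt_divide)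
  have nz: "sqrt (1 + ?u\<^sup>2) \<noteq> 0"
    by (simp add: add_nonneg_eq_0_iff)
  show "sqrt h * sin (arctan (inverse ?u)) = ?u"
    using u nz by (simp add: sin_arctan s r)
  show "sqrt h * cos (arctan (inverse ?u)) = ?u\<^sup>2"
    using u nz by (simp add: cos_arctan s r) (simp add: power2_eq_square)
qed

text \<open>In this form the angle depends on u alone, and its derivative with respect to u is the
  rational function -1/(1 + u^2).\<close>

lemma thA_arctan:
  assumes "0 < h"
  shows "thA h = arctan (inverse (uu h))"
proof -
  have "sin (arctan (inverse (uu h))) = uu h / sqrt h"
    using sin_arctan_uu[OF assms] assms by (simp add: eq_divide_eq mult.commute)
  then have "thA h = arcsin (sin (arctan (inverse (uu h))))" by (simp only: thA_def)
  also have "\<dots> = arctan (inverse (uu h))"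
    using arctan_lbound[of "inverse (uu h)"] arctan_ubound[of "inverse (uu h)"]
    by (intro arcsin_sin) auto
  finally show ?thesis .
qed

lemma sin_thA: "0 < h \<Longrightarrow> sqrt h * sin (thA h) = uu h"
  and cos_thA: "0 < h \<Longrightarrow> sqrt h * cos (thA h) = (uu h)\<^sup>2"
  by (simp_all only: thA_arctan sin_arctan_uu cos_arctan_uu)

lemma thA_bounds:
  assumes "0 < h"
  shows "0 < thA h" "thA h < pi / 2"
  using assms uu_pos[OF assms] arctan_ubound by (auto simp: thA_arctan)

lemma thA_has_deriv:
  assumes "0 < h"
  shows "(thA has_real_derivative - inverse (2 * uu h * (1 + (uu h)\<^sup>2) * (1 + 2 * (uu h)\<^sup>2))) (at h)"
proof -
  let ?u = "uu h"
  have u: "0 < ?u" by (rule uu_pos[OF assms])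
  define k where "k = inverse (2 * ?u * (1 + 2 * ?u\<^sup>2))"
  have "(uu has_real_derivative k) (at h)"
    unfolding k_def by (rule uu_has_deriv[OF assms])
  then have "((\<lambda>h. arctan (inverse (uu h))) has_real_derivative
      inverse (1 + (inverse ?u)\<^sup>2) * - (inverse ?u * k * inverse ?u)) (at h)"
    using u by (intro DERIV_chain2[OF DERIV_arctan] DERIV_inverse') auto
  then have "(thA has_real_derivative inverse (1 + (inverse ?u)\<^sup>2) * - (inverse ?u * k * inverse ?u)) (at h)"
    by (rule has_field_derivative_transform_within_open[of _ _ _ "{0<..}"])
      (use assms in \<open>auto simp: thA_arctan\<close>)
  moreover have "inverse (1 + (inverse ?u)\<^sup>2) * - (inverse ?u * k * inverse ?u) = - (inverse (1 + ?u\<^sup>2) * k)"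
  proof -
    have "1 + (inverse ?u)\<^sup>2 = (1 + ?u\<^sup>2) * (inverse ?u * inverse ?u)"
      using u by (simp add: field_simps power2_eq_square)
    then show ?thesis
      using u one_plus_uu_pos(1)[of h] by (simp add: inverse_mult_distrib field_simps)
  qed
  ultimately show ?thesis
    by (simp only: k_def inverse_mult_distrib mult_ac)
qed

text \<open>Bootstrapping: u' is a rational expression in u without poles for h > 0, so k
  derivatives of u yield k + 1.\<close>

lemma smooth_uu: "smooth {0<..} uu"
proof -
  have "diff_times {0<..} k uu" for k
  proof (induction k)
    case (Suc k)
    show ?case
    proof (rule diff_times_SucI)
      show "(uu has_real_derivative inverse (2 * uu h * (1 + 2 * (uu h * uu h)))) (at h)"
        if "h \<in> {0<..}" for h
        using uu_has_deriv[of h] that by (simp add: power2_eq_square)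
      show "diff_times {0<..} k (\<lambda>h. inverse (2 * uu h * (1 + 2 * (uu h * uu h))))"
      proof (intro diff_times_inverse diff_times_mult diff_times_add diff_times_const Suc)
        show "2 * uu h * (1 + 2 * (uu h * uu h)) \<noteq> 0" if "h \<in> {0<..}" for h
          using uu_pos[of h] one_plus_uu_pos(2)[of h] that by (simp add: power2_eq_square)
      qed auto
    qed simp
  qed simp
  then show ?thesis by (simp add: smooth_def)
qed

lemma smooth_thA: "smooth {0<..} thA"
proof (rule smooth_of_deriv)
  show "(thA has_real_derivative
      (-1) * inverse (2 * uu h * (1 + (uu h)\<^sup>2) * (1 + 2 * (uu h)\<^sup>2))) (at h)" if "h \<in> {0<..}" for h
    using thA_has_deriv[of h] that by simp
  show "smooth {0<..} (\<lambda>h. (-1) * inverse (2 * uu h * (1 + (uu h)\<^sup>2) * (1 + 2 * (uu h)\<^sup>2)))"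
  proof (intro smooth_mult smooth_inverse smooth_add smooth_power smooth_const smooth_uu)
    show "2 * uu h * (1 + (uu h)\<^sup>2) * (1 + 2 * (uu h)\<^sup>2) \<noteq> 0" if "h \<in> {0<..}" for h
      using uu_pos[of h] one_plus_uu_pos[of h] that by simp
  qed auto
qed simp

section \<open>A class of functions closed under differentiation\<close>

definition den :: "nat \<Rightarrow> nat \<Rightarrow> nat \<Rightarrow> real \<Rightarrow> real" where
  "den a b c w = w ^ a * (1 + w) ^ b * (1 + 2 * w) ^ c"

text \<open>The shape of every iterated derivative of M/h. The powers in the denominator come from
  u' = u/(2w(1 + 2w)), from \<theta>' = -u/(2w(1 + w)(1 + 2w)) and from 1/h.\<close>

definition elem :: "real poly \<Rightarrow> real poly \<Rightarrow> real poly \<Rightarrow> nat \<Rightarrow> nat \<Rightarrow> nat \<Rightarrow> real \<Rightarrow> real" where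
  "elem p q R a b c h = poly p h + poly q h * thA h + uu h * poly R ((uu h)\<^sup>2) / den a b c ((uu h)\<^sup>2)"

text \<open>The numerator of d/dw of w^(1/2 - a) (1 + w)^(-b) R, the 1/2 being the exponent of u as
  a power of w.\<close>

definition diff_part :: "nat \<Rightarrow> nat \<Rightarrow> real poly \<Rightarrow> real poly" where
  "diff_part a b R = smult (1 / 2 - real a) ([:1, 1:] * R) - smult (real b) ([:0, 1:] * R)
     + [:0, 1:] * ([:1, 1:] * pderiv R)"

text \<open>The term q \<theta>' brought, up to sign, to the common denominator;
  \<open>[:0, 1, 1:]\<close> is h as a polynomial in w.\<close>

definition theta_part :: "nat \<Rightarrow> nat \<Rightarrow> nat \<Rightarrow> real poly \<Rightarrow> real poly" where
  "theta_part a b c q =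
     smult (1 / 2) (pcompose q [:0, 1, 1:] * ([:0, 1:] ^ a * ([:1, 1:] ^ b * [:1, 2:] ^ c)))"

definition next_num :: "nat \<Rightarrow> nat \<Rightarrow> nat \<Rightarrow> real poly \<Rightarrow> real poly \<Rightarrow> real poly" where
  "next_num a b c q R = [:1, 2:] * diff_part a b R - smult (2 * real c) ([:0, 1:] * ([:1, 1:] * R))
     - theta_part a b (Suc c) q"

lemma den_pos: "0 < w \<Longrightarrow> 0 < den a b c w"
  by (simp add: den_def add_pos_pos)

text \<open>The logarithmic form covers n = 0 uniformly and makes the derivative of
  \<open>den\<close> a multiple of \<open>den\<close>.\<close>

lemma power_has_deriv:
  fixes f :: "real \<Rightarrow> real"
  assumes "(f has_real_derivative f') (at x)" "f x \<noteq> 0"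
  shows "((\<lambda>x. f x ^ n) has_real_derivative f x ^ n * (real n / f x * f')) (at x)"
proof (cases n)
  case (Suc m)
  show ?thesis
    unfolding Suc by (rule derivative_eq_intros assms refl)+ (use assms in simp)
qed simp

lemma den_has_deriv:
  assumes "0 < w"
  shows "(den a b c has_real_derivative
    den a b c w * (real a / w + real b / (1 + w) + 2 * real c / (1 + 2 * w))) (at w)"
proof -
  have "1 + w \<noteq> 0" "1 + 2 * w \<noteq> 0" "w \<noteq> 0" using assms by linarith+
  then have "((\<lambda>w. w ^ a * (1 + w) ^ b * (1 + 2 * w) ^ c) has_real_derivative
      ((w ^ a * (real a / w * 1)) * (1 + w) ^ b + ((1 + w) ^ b * (real b / (1 + w) * 1)) * w ^ a)
        * (1 + 2 * w) ^ c
      + ((1 + 2 * w) ^ c * (real c / (1 + 2 * w) * 2)) * (w ^ a * (1 + w) ^ b)) (at w)"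
    by (intro DERIV_mult power_has_deriv) (auto intro!: derivative_eq_intros)
  then show ?thesis
    unfolding den_def[abs_def] by (rule DERIV_cong) (simp add: algebra_simps)
qed

text \<open>With w, x = 1 + w, y = 1 + 2w and the denominator D treated as independent unknowns, the
  quotient rule for \<open>elem\<close> becomes a plain identity of rational functions.\<close>

lemma next_num_identity:
  fixes u w x y D A B Q a b c :: real
  assumes "w \<noteq> 0" "x \<noteq> 0" "y \<noteq> 0" "D \<noteq> 0"
  shows "- (u / (2 * w * x * y)) * Q
      + ((u / (2 * w * y) * A + B * inverse y * u) * D
          - u * A * (D * (a / w + b / x + 2 * c / y) * inverse y)) / (D * D)
    = u * (y * ((1 / 2 - a) * (x * A) - b * (w * A) + w * (x * B)) - 2 * c * (w * (x * A))
        - 1 / 2 * (Q * (D * y))) / (D * w * x * (y * y))"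
proof -
  have 1: "(X * D - u * A * (D * K * inverse y)) / (D * D) = (X - u * A * K * inverse y) / D" for X K
    using assms(4) by (simp add: divide_simps) (simp add: algebra_simps)
  have 2: "u / (2 * w * y) * A + B * inverse y * u - u * A * (a / w + b / x + 2 * c / y) * inverse y
     = u * (y * ((1 / 2 - a) * (x * A) - b * (w * A) + w * (x * B)) - 2 * c * (w * (x * A))) / (w * x * (y * y))"
    using assms(1-3) by (simp add: field_simps)
  show ?thesis unfolding 1 2
    using assms by (simp add: field_simps)
qed

lemma elem_has_deriv:
  assumes h: "0 < h"
  shows "(elem p q R a b c has_real_derivative
    elem (pderiv p) (pderiv q) (next_num a b c q R) (Suc a) (Suc b) (Suc (Suc c)) h) (at h)"
proof -
  define u where "u = uu h"
  define w where "w = (uu h)\<^sup>2"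
  define D where "D = den a b c w"
  have u: "0 < u" by (simp add: u_def uu_pos[OF h])
  have uw: "u * u = w" by (simp add: u_def w_def power2_eq_square)
  have w: "0 < w" "1 + w \<noteq> 0" "1 + 2 * w \<noteq> 0"
    using uu_pos[OF h] one_plus_uu_pos[of h] by (auto simp: w_def)
  have D: "0 < D" unfolding D_def by (rule den_pos[OF w(1)])
  have Dnz: "den a b c ((uu h)\<^sup>2) \<noteq> 0" using D by (simp add: D_def w_def)
  have iu: "inverse u = u / w" using u by (simp add: field_simps flip: uw)
  have u': "(uu has_real_derivative u / (2 * w * (1 + 2 * w))) (at h)"
    using uu_has_deriv[OF h] unfolding w_def[symmetric] unfolding u_def[symmetric]
    by (rule DERIV_cong) (simp only: inverse_mult_distrib iu divide_inverse mult_ac)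
  have w': "((\<lambda>h. (uu h)\<^sup>2) has_real_derivative inverse (1 + 2 * w)) (at h)"
    using uu_sq_has_deriv[OF h] by (simp add: w_def)
  have th': "(thA has_real_derivative - (u / (2 * w * (1 + w) * (1 + 2 * w)))) (at h)"
    using thA_has_deriv[OF h] unfolding w_def[symmetric] unfolding u_def[symmetric]
    by (rule DERIV_cong) (simp only: inverse_mult_distrib iu divide_inverse mult_ac)
  have R': "((\<lambda>h. poly R ((uu h)\<^sup>2)) has_real_derivative poly (pderiv R) w * inverse (1 + 2 * w)) (at h)"
    unfolding w_def by (rule DERIV_chain2[OF poly_DERIV w'[unfolded w_def]])
  have D': "((\<lambda>h. den a b c ((uu h)\<^sup>2)) has_real_derivative
      D * (real a / w + real b / (1 + w) + 2 * real c / (1 + 2 * w)) * inverse (1 + 2 * w)) (at h)"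
    unfolding D_def w_def
    by (rule DERIV_chain2[OF den_has_deriv w'[unfolded w_def]]) (use w(1) in \<open>simp add: w_def\<close>)
  have "(elem p q R a b c has_real_derivative
     (poly (pderiv p) h + (poly (pderiv q) h * thA h + - (u / (2 * w * (1 + w) * (1 + 2 * w))) * poly q h))
      + ((u / (2 * w * (1 + 2 * w)) * poly R w + poly (pderiv R) w * inverse (1 + 2 * w) * u) * D
          - u * poly R w * (D * (real a / w + real b / (1 + w) + 2 * real c / (1 + 2 * w)) * inverse (1 + 2 * w)))
        / (D * D)) (at h)"
    unfolding elem_def[abs_def]
    by (rule DERIV_cong[OF DERIV_add[OF DERIV_add[OF poly_DERIV DERIV_mult[OF poly_DERIV th']]
          DERIV_divide[OF DERIV_mult[OF u' R'] D' Dnz]]])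
      (simp only: u_def w_def D_def)
  note deriv = this
  have den: "den (Suc a) (Suc b) (Suc (Suc c)) w = D * w * (1 + w) * ((1 + 2 * w) * (1 + 2 * w))"
    by (simp add: D_def den_def)
  have num: "poly (next_num a b c q R) w =
      (1 + 2 * w) * ((1 / 2 - real a) * ((1 + w) * poly R w) - real b * (w * poly R w)
        + w * ((1 + w) * poly (pderiv R) w))
      - 2 * real c * (w * ((1 + w) * poly R w)) - 1 / 2 * (poly q h * (D * (1 + 2 * w)))"
  proof -
    have "w * (1 + w) = h" unfolding w_def by (rule uu_eq[OF h])
    then have "poly [:0, 1, 1:] w = h" by (simp add: algebra_simps)
    then show ?thesis
      by (simp add: next_num_def diff_part_def theta_part_def poly_pcompose D_def den_def field_simps)
  qed
  have id: "- (u / (2 * w * (1 + w) * (1 + 2 * w))) * poly q h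
      + ((u / (2 * w * (1 + 2 * w)) * poly R w + poly (pderiv R) w * inverse (1 + 2 * w) * u) * D
          - u * poly R w * (D * (real a / w + real b / (1 + w) + 2 * real c / (1 + 2 * w)) * inverse (1 + 2 * w)))
        / (D * D)
    = u * poly (next_num a b c q R) w / den (Suc a) (Suc b) (Suc (Suc c)) w"
    unfolding num den by (rule next_num_identity) (use w D in auto)
  show ?thesis
    by (rule DERIV_cong[OF deriv])
      (unfold elem_def w_def[symmetric], unfold u_def[symmetric] id[symmetric], simp only: add_ac)
qed

lemma smooth_den: "smooth {0<..} (\<lambda>h. den a b c ((uu h)\<^sup>2))"
  unfolding den_def by (intro smooth_mult smooth_power smooth_add smooth_const smooth_uu) auto

lemma den_uu_pos: "0 < h \<Longrightarrow> 0 < den a b c ((uu h)\<^sup>2)"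
  by (intro den_pos) (use uu_pos[of h] in simp)

lemma smooth_elem: "smooth {0<..} (elem p q R a b c)"
proof -
  have "den a b c ((uu h)\<^sup>2) \<noteq> 0" if "h \<in> {0<..}" for h
    using den_uu_pos[of h a b c] that by simp
  then show ?thesis
    unfolding elem_def[abs_def]
    by (intro smooth_add smooth_mult smooth_divide smooth_poly smooth_ident smooth_thA smooth_uu
        smooth_den smooth_power) auto
qed

text \<open>The end of the descent: once p and q are gone, the zeros are those of R(w), and w has
  nonvanishing derivative in h.\<close>

lemma zeros_le_elem_0:
  assumes "\<exists>h>0. elem 0 0 R a b c h \<noteq> 0"
  shows "zeros_le {0<..} (elem 0 0 R a b c) (degree R)"
proof (rule zeros_le_factor)
  have R: "R \<noteq> 0" using assms by (auto simp: elem_def)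
  have "zeros_le {0<..} (\<lambda>h. poly R ((uu h)\<^sup>2)) (degree R)"
  proof (rule zeros_le_poly_comp[OF _ _ _ _ _ R])
    show "((\<lambda>h. (uu h)\<^sup>2) has_real_derivative inverse (1 + 2 * (uu h)\<^sup>2)) (at h)"
      if "h \<in> {0<..}" for h using uu_sq_has_deriv that by simp
    show "inverse (1 + 2 * (uu h)\<^sup>2) \<noteq> 0" for h
      using one_plus_uu_pos(2)[of h] by simp
  qed (auto intro: smooth_power smooth_uu)
  then show "zeros_le {0<..} (\<lambda>h. elem 0 0 R a b c h * (den a b c ((uu h)\<^sup>2) * inverse (uu h))) (degree R)"
  proof (rule zeros_le_cong[rotated 2])
    show "poly R ((uu h)\<^sup>2) = elem 0 0 R a b c h * (den a b c ((uu h)\<^sup>2) * inverse (uu h))"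
      if "h \<in> {0<..}" for h
      using den_uu_pos[of h a b c] uu_pos[of h] that by (simp add: elem_def)
  qed simp
  show "smooth {0<..} (\<lambda>h. den a b c ((uu h)\<^sup>2) * inverse (uu h))"
  proof (intro smooth_mult smooth_inverse smooth_den smooth_uu)
    show "uu h \<noteq> 0" if "h \<in> {0<..}" for h using uu_pos[of h] that by simp
  qed auto
qed (auto intro: smooth_elem)

lemma degree_diff_part: "degree (diff_part a b R) \<le> Suc (degree R)"
proof -
  have 1: "degree ([:1, 1:] * R) \<le> Suc (degree R)" "degree ([:0, 1:] * R) \<le> Suc (degree R)"
    using degree_mult_le[of "[:1, 1:]" R] degree_mult_le[of "[:0, 1:]" R] by simp_all
  have 2: "degree ([:0, 1:] * ([:1, 1:] * pderiv R)) \<le> Suc (degree R)"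
  proof (cases "pderiv R = 0")
    \<comment> \<open>Here degree R >= 1, so the truncated degree of \<open>pderiv R\<close> is a
      true degree R - 1.\<close>
    case False
    then have "degree R \<noteq> 0" by (simp add: pderiv_eq_0_iff)
    then show ?thesis
      using degree_mult_le[of "[:0, 1:]" "[:1, 1:] * pderiv R"] degree_mult_le[of "[:1, 1:]" "pderiv R"]
      by (simp add: degree_pderiv)
  qed simp
  show ?thesis
    unfolding diff_part_def
    by (intro degree_add_le degree_diff_le order_trans[OF degree_smult_le] 1 2)
qed

text \<open>Degree N - 1 in h becomes 2(N - 1) in w. Adding 2 on the left avoids truncated
  subtraction; the second alternative is needed for N = 0.\<close>

lemma degree_theta_part:
  assumes "q = 0 \<or> degree q < N"
  shows "degree (theta_part a b c q) + 2 \<le> 2 * N + a + b + c \<or> theta_part a b c q = 0"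
proof (cases "q = 0")
  case False
  have "degree (theta_part a b c q) \<le> degree (pcompose q [:0, 1, 1:]) + (a + (b + c))"
    unfolding theta_part_def
    by (intro order_trans[OF degree_smult_le] order_trans[OF degree_mult_le] add_mono order_refl
        order_trans[OF degree_power_le]) simp_all
  then show ?thesis using assms False by (simp add: degree_pcompose)
qed (simp add: theta_part_def)

text \<open>The \<theta>-term has degree at most 2N - 2 + a + b + (c + 1), and this is at most s + 2
  exactly under the third hypothesis.\<close>

lemma degree_next_num:
  assumes "q = 0 \<or> degree q < N" "degree R \<le> s" "2 * N + a + b + c \<le> s + 3"
  shows "degree (next_num a b c q R) \<le> s + 2"
proof -
  have "degree ([:1, 2:] * diff_part a b R) \<le> s + 2"
    using degree_mult_le[of "[:1, 2:]" "diff_part a b R"] degree_diff_part[of a b R] assms(2) by simp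
  moreover have "degree (smult (2 * real c) ([:0, 1:] * ([:1, 1:] * R))) \<le> s + 2"
    using degree_mult_le[of "[:0, 1:]" "[:1, 1:] * R"] degree_mult_le[of "[:1, 1:]" R] assms(2)
    by (intro order_trans[OF degree_smult_le]) simp
  moreover have "degree (theta_part a b (Suc c) q) \<le> s + 2"
    using degree_theta_part[OF assms(1), of a b "Suc c"] assms(3) by auto
  ultimately show ?thesis
    unfolding next_num_def by (intro degree_diff_le)
qed

text \<open>In this encoding N = 0 means the zero polynomial, so N counts the derivatives that still
  have to be taken.\<close>

lemma pderiv_degree_less:
  fixes p :: "real poly"
  assumes "p = 0 \<or> degree p < Suc N"
  shows "pderiv p = 0 \<or> degree (pderiv p) < N"
  using assms by (auto simp: degree_pderiv pderiv_eq_0_iff)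

text \<open>The inequality \<open>2 * N + a + b + c \<le> s + 3\<close> keeps the derivative of the \<open>\<theta>\<close>-term within the
  degree of the next numerator, and is inherited by the next step.\<close>

lemma zeros_le_elem:
  assumes "p = 0 \<or> degree p < N" "q = 0 \<or> degree q < N" "degree R \<le> s"
    and "2 * N + a + b + c \<le> s + 3" "\<exists>h>0. elem p q R a b c h \<noteq> 0"
  shows "zeros_le {0<..} (elem p q R a b c) (s + 3 * N)"
  using assms
proof (induction N arbitrary: p q R a b c s)
  case 0
  then show ?case using zeros_le_elem_0[of R a b c] zeros_le_mono by auto
next
  case (Suc N)
  \<comment> \<open>Degree +2 and Rolle +1. The side condition is stable: 2N falls by 2, the
    exponents rise by 4 in total, and s rises by 2.\<close>
  have "zeros_le {0<..} (elem p q R a b c) (Suc (s + 2 + 3 * N))"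
  proof (rule zeros_le_of_deriv)
    show "(elem p q R a b c has_real_derivative
        elem (pderiv p) (pderiv q) (next_num a b c q R) (Suc a) (Suc b) (Suc (Suc c)) h) (at h)"
      if "h \<in> {0<..}" for h using elem_has_deriv that by simp
    show "zeros_le {0<..} (elem (pderiv p) (pderiv q) (next_num a b c q R) (Suc a) (Suc b) (Suc (Suc c)))
        (s + 2 + 3 * N)"
      if "\<exists>h\<in>{0<..}. elem (pderiv p) (pderiv q) (next_num a b c q R) (Suc a) (Suc b) (Suc (Suc c)) h \<noteq> 0"
      using Suc.prems that
      by (intro Suc.IH pderiv_degree_less degree_next_num[where N = "Suc N"]) auto
  qed (use Suc.prems smooth_elem in \<open>auto simp: is_interval_convex_1\<close>)
  then show ?case by (rule zeros_le_mono) simp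
qed

text \<open>For c = 0 the derivative of the algebraic part gains only one factor 1 + 2w. Without this
  saving the bound for n = 1 would be 4.\<close>

lemma zeros_le_elem_first:
  assumes p: "p = 0 \<or> degree p < Suc N" and q: "q = 0 \<or> degree q < Suc N"
    and R: "degree R \<le> n" and N: "2 * N < n" and nz: "\<exists>h>0. elem p q R 1 1 0 h \<noteq> 0"
  shows "zeros_le {0<..} (elem p q R 1 1 0) (n + 3 * N + 2)"
proof -
  define R' where "R' = diff_part 1 1 R - theta_part 1 1 0 q"
  have elem_eq: "elem (pderiv p) (pderiv q) (next_num 1 1 0 q R) (Suc 1) (Suc 1) (Suc (Suc 0)) h
      = elem (pderiv p) (pderiv q) R' 2 2 1 h" for h
  proof -
    have "poly (next_num 1 1 0 q R) w = (1 + 2 * w) * poly R' w" for w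
      by (simp add: next_num_def R'_def theta_part_def field_simps)
    moreover have "den 2 2 2 w = (1 + 2 * w) * den 2 2 1 w" for w
      by (simp add: den_def power2_eq_square)
    ultimately show ?thesis
      using one_plus_uu_pos(2)[of h] by (simp add: elem_def numeral_2_eq_2)
  qed
  have "zeros_le {0<..} (elem p q R 1 1 0) (Suc (Suc n + 3 * N))"
  proof (rule zeros_le_of_deriv)
    show "(elem p q R 1 1 0 has_real_derivative elem (pderiv p) (pderiv q) R' 2 2 1 h) (at h)"
      if "h \<in> {0<..}" for h using elem_has_deriv[of h p q R 1 1 0] that by (simp only: elem_eq) simp
    have "degree R' \<le> Suc n"
      unfolding R'_def using degree_diff_part[of 1 1 R] R degree_theta_part[OF q, of 1 1 0] N
      by (intro degree_diff_le) auto
    \<comment> \<open>The side condition reads 2N + 2 + 2 + 1 <= (n + 1) + 3, which is just 2N <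
      n.\<close>
    then show "zeros_le {0<..} (elem (pderiv p) (pderiv q) R' 2 2 1) (Suc n + 3 * N)"
      if "\<exists>h\<in>{0<..}. elem (pderiv p) (pderiv q) R' 2 2 1 h \<noteq> 0"
      using that N p q by (intro zeros_le_elem pderiv_degree_less) auto
  qed (use nz smooth_elem in \<open>auto simp: is_interval_convex_1\<close>)
  then show ?thesis by (rule zeros_le_mono) simp
qed

section \<open>Zero bound for functions of Melnikov shape\<close>

definition mel_form :: "nat \<Rightarrow> (real \<Rightarrow> real) \<Rightarrow> bool" where
  "mel_form n F \<longleftrightarrow> (\<exists>p q R. (p = 0 \<or> degree p < Suc ((n - 1) div 2)) \<and>
     (q = 0 \<or> degree q < Suc ((n - 1) div 2)) \<and> degree R \<le> n \<and>
     (\<forall>h>0. F h = h * (poly p h + poly q h * thA h) + uu h * poly R ((uu h)\<^sup>2)))"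

text \<open>Since 1/h = 1/(w(1 + w)), the quotient F/h is an \<open>elem\<close> with exponents 1,
  1, 0; the positive factor h leaves the zero count unchanged.\<close>

lemma num_zeros_mel_form:
  assumes "mel_form n F" "1 \<le> n" "\<exists>h>0. F h \<noteq> 0"
  shows "num_zeros F \<le> enat (n + 3 * ((n - 1) div 2) + 2)"
proof -
  define N where "N = (n - 1) div 2"
  obtain p q R where pq: "p = 0 \<or> degree p < Suc N" "q = 0 \<or> degree q < Suc N" "degree R \<le> n"
    and F: "\<And>h. 0 < h \<Longrightarrow> F h = h * (poly p h + poly q h * thA h) + uu h * poly R ((uu h)\<^sup>2)"
    using assms(1) unfolding mel_form_def N_def by blast
  have Fe: "F h = h * elem p q R 1 1 0 h" if "0 < h" for h
  proof -
    have "h * (X / den 1 1 0 ((uu h)\<^sup>2)) = X" for X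
      using uu_eq[OF that] that by (simp add: den_def)
    then show ?thesis by (simp add: F[OF that] elem_def distrib_left)
  qed
  have "zeros_le {0<..} (elem p q R 1 1 0) (n + 3 * N + 2)"
  proof (rule zeros_le_elem_first[OF pq])
    show "2 * N < n" using assms(2) unfolding N_def by linarith
    show "\<exists>h>0. elem p q R 1 1 0 h \<noteq> 0" using assms(3) Fe by force
  qed
  then have "zeros_le {0<..} (\<lambda>h. h * elem p q R 1 1 0 h * inverse h) (n + 3 * N + 2)"
    by (rule zeros_le_cong[rotated 2]) auto
  then have "zeros_le {0<..} (\<lambda>h. h * elem p q R 1 1 0 h) (n + 3 * N + 2)"
    by (rule zeros_le_factor[rotated 3])
      (auto intro!: smooth_mult smooth_ident smooth_elem smooth_inverse)
  then have "zeros_le {0<..} F (n + 3 * N + 2)"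
    by (rule zeros_le_cong[rotated 2]) (use Fe in auto)
  then show ?thesis unfolding N_def by (rule num_zeros_le)
qed

section \<open>The shape of the Melnikov function\<close>

lemma mel_form_cong: "(\<And>h. 0 < h \<Longrightarrow> F h = G h) \<Longrightarrow> mel_form n F \<Longrightarrow> mel_form n G"
  unfolding mel_form_def by (metis (no_types, lifting))

lemma poly_degree_less_add:
  fixes p q :: "real poly"
  shows "p = 0 \<or> degree p < N \<Longrightarrow> q = 0 \<or> degree q < N \<Longrightarrow> p + q = 0 \<or> degree (p + q) < N"
  by (auto intro: degree_add_less)

lemma mel_form_add:
  assumes "mel_form n F" "mel_form n G"
  shows "mel_form n (\<lambda>h. F h + G h)"
proof -
  define N where "N = Suc ((n - 1) div 2)"
  obtain p q R where 1: "p = 0 \<or> degree p < N" "q = 0 \<or> degree q < N" "degree R \<le> n"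
    "\<forall>h>0. F h = h * (poly p h + poly q h * thA h) + uu h * poly R ((uu h)\<^sup>2)"
    using assms(1) unfolding mel_form_def N_def by blast
  obtain p' q' R' where 2: "p' = 0 \<or> degree p' < N" "q' = 0 \<or> degree q' < N" "degree R' \<le> n"
    "\<forall>h>0. G h = h * (poly p' h + poly q' h * thA h) + uu h * poly R' ((uu h)\<^sup>2)"
    using assms(2) unfolding mel_form_def N_def by blast
  show ?thesis
    unfolding mel_form_def N_def[symmetric]
    using 1(4) 2(4) poly_degree_less_add[OF 1(1) 2(1)] poly_degree_less_add[OF 1(2) 2(2)]
      degree_add_le[OF 1(3) 2(3)]
    by (intro exI[of _ "p + p'"] exI[of _ "q + q'"] exI[of _ "R + R'"]) (auto simp: algebra_simps)
qed

lemma mel_form_scale: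
  assumes "mel_form n F"
  shows "mel_form n (\<lambda>h. c * F h)"
proof -
  define N where "N = Suc ((n - 1) div 2)"
  obtain p q R where 1: "p = 0 \<or> degree p < N" "q = 0 \<or> degree q < N" "degree R \<le> n"
    "\<forall>h>0. F h = h * (poly p h + poly q h * thA h) + uu h * poly R ((uu h)\<^sup>2)"
    using assms(1) unfolding mel_form_def N_def by blast
  have "smult c p = 0 \<or> degree (smult c p) < N" "smult c q = 0 \<or> degree (smult c q) < N"
    "degree (smult c R) \<le> n"
    using 1(1-3) by auto
  then show ?thesis
    unfolding mel_form_def N_def[symmetric] using 1(4)
    by (intro exI[of _ "smult c p"] exI[of _ "smult c q"] exI[of _ "smult c R"])
      (auto simp: algebra_simps)
qed

lemma mel_form_sum:
  assumes "finite A" "\<And>i. i \<in> A \<Longrightarrow> mel_form n (F i)"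
  shows "mel_form n (\<lambda>h. \<Sum>i\<in>A. F i h)"
  using assms
proof (induction A rule: finite_induct)
  case empty
  show ?case unfolding mel_form_def by (intro exI[of _ 0]) auto
next
  case (insert i A)
  then show ?case using mel_form_add[of n "F i" "\<lambda>h. \<Sum>i\<in>A. F i h"] by simp
qed

text \<open>The contribution of monomials of total degree d; only even d produces an arc-length
  term. Bounding coefficients instead of the degree forces R = 0 for d = 0.\<close>

definition hom_form :: "nat \<Rightarrow> (real \<Rightarrow> real) \<Rightarrow> bool" where
  "hom_form d F \<longleftrightarrow> (\<exists>\<alpha> \<beta> R. (\<forall>k\<ge>d. coeff R k = 0) \<and>
     (\<forall>h>0. F h = (if even d then h ^ (d div 2) * (\<alpha> + \<beta> * thA h) else 0)
        + uu h * poly R ((uu h)\<^sup>2)))"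

text \<open>The differential form raises the degree by one, hence d <= n + 1; for even d, taking out
  h leaves the exponent d/2 - 1 <= [(n - 1)/2].\<close>

lemma mel_form_of_hom_form:
  assumes "hom_form d F" "1 \<le> d" "d \<le> n + 1"
  shows "mel_form n F"
proof -
  obtain \<alpha> \<beta> R where R: "\<forall>k\<ge>d. coeff R k = 0"
    and F: "\<forall>h>0. F h = (if even d then h ^ (d div 2) * (\<alpha> + \<beta> * thA h) else 0)
        + uu h * poly R ((uu h)\<^sup>2)"
    using assms(1) unfolding hom_form_def by blast
  have "degree R \<le> n" using R assms(3) by (intro degree_le) auto
  show ?thesis
  proof (cases "even d")
    case True
    then have d: "d div 2 = Suc (d div 2 - 1)" using assms(2) by (auto elim!: evenE)
    have le: "degree (monom c (d div 2 - 1)) < Suc ((n - 1) div 2)" for c :: real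
      using degree_monom_le[of c "d div 2 - 1"] assms(3) by linarith
    have "h ^ (d div 2) = h * h ^ (d div 2 - 1)" for h :: real
      by (subst d) simp
    then show ?thesis
      unfolding mel_form_def using F True le \<open>degree R \<le> n\<close>
      by (intro exI[of _ "monom \<alpha> (d div 2 - 1)"] exI[of _ "monom \<beta> (d div 2 - 1)"] exI[of _ R])
        (auto simp: poly_monom algebra_simps)
  next
    case False
    then show ?thesis
      unfolding mel_form_def using F \<open>degree R \<le> n\<close>
      by (intro exI[of _ 0] exI[of _ R]) auto
  qed
qed

lemma hom_form_cong: "(\<And>h. 0 < h \<Longrightarrow> F h = G h) \<Longrightarrow> hom_form n F \<Longrightarrow> hom_form n G"
  unfolding hom_form_def by (metis (no_types, lifting))

lemma hom_form_add:
  assumes "hom_form d F" "hom_form d G"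
  shows "hom_form d (\<lambda>h. F h + G h)"
proof -
  obtain \<alpha> \<beta> R where 1: "\<forall>k\<ge>d. coeff R k = 0"
    "\<forall>h>0. F h = (if even d then h ^ (d div 2) * (\<alpha> + \<beta> * thA h) else 0) + uu h * poly R ((uu h)\<^sup>2)"
    using assms(1) unfolding hom_form_def by blast
  obtain \<alpha>' \<beta>' R' where 2: "\<forall>k\<ge>d. coeff R' k = 0"
    "\<forall>h>0. G h = (if even d then h ^ (d div 2) * (\<alpha>' + \<beta>' * thA h) else 0) + uu h * poly R' ((uu h)\<^sup>2)"
    using assms(2) unfolding hom_form_def by blast
  show ?thesis
    unfolding hom_form_def using 1 2
    by (intro exI[of _ "\<alpha> + \<alpha>'"] exI[of _ "\<beta> + \<beta>'"] exI[of _ "R + R'"]) (auto simp: algebra_simps)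
qed

lemma hom_form_scale:
  assumes "hom_form d F"
  shows "hom_form d (\<lambda>h. c * F h)"
proof -
  obtain \<alpha> \<beta> R where 1: "\<forall>k\<ge>d. coeff R k = 0"
    "\<forall>h>0. F h = (if even d then h ^ (d div 2) * (\<alpha> + \<beta> * thA h) else 0) + uu h * poly R ((uu h)\<^sup>2)"
    using assms(1) unfolding hom_form_def by blast
  then show ?thesis
    unfolding hom_form_def
    by (intro exI[of _ "c * \<alpha>"] exI[of _ "c * \<beta>"] exI[of _ "smult c R"]) (auto simp: algebra_simps)
qed

text \<open>Multiplication by h = w + w^2 raises the degree in w by 2, in step with d.\<close>

lemma hom_form_mult:
  assumes "hom_form d F"
  shows "hom_form (Suc (Suc d)) (\<lambda>h. h * F h)"
proof -
  obtain \<alpha> \<beta> R where R: "\<forall>k\<ge>d. coeff R k = 0"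
    and F: "\<forall>h>0. F h = (if even d then h ^ (d div 2) * (\<alpha> + \<beta> * thA h) else 0)
        + uu h * poly R ((uu h)\<^sup>2)"
    using assms(1) unfolding hom_form_def by blast
  define R' where "R' = pCons 0 R + pCons 0 (pCons 0 R)"
  have hR: "h * poly R ((uu h)\<^sup>2) = poly R' ((uu h)\<^sup>2)" if "0 < h" for h
  proof -
    have "h * poly R ((uu h)\<^sup>2) = ((uu h)\<^sup>2 * (1 + (uu h)\<^sup>2)) * poly R ((uu h)\<^sup>2)"
      by (simp only: uu_eq[OF that])
    then show ?thesis by (simp add: R'_def algebra_simps)
  qed
  have "h * F h = (if even (Suc (Suc d)) then h ^ (Suc (Suc d) div 2) * (\<alpha> + \<beta> * thA h) else 0)
        + uu h * poly R' ((uu h)\<^sup>2)" if "0 < h" for h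
    unfolding hR[OF that, symmetric] using F that by (simp add: algebra_simps)
  moreover have "\<forall>k\<ge>Suc (Suc d). coeff R' k = 0"
    using R by (auto simp: R'_def coeff_pCons split: nat.splits)
  ultimately show ?thesis
    unfolding hom_form_def by blast
qed

lemma hom_form_uu: "hom_form (Suc d) (\<lambda>h. c * uu h * ((uu h)\<^sup>2) ^ d)"
  unfolding hom_form_def
  by (intro exI[of _ 0] exI[of _ "monom c d"]) (auto simp: poly_monom)

section \<open>Integrals of monomials over circular arcs\<close>

definition mono_int :: "nat \<Rightarrow> nat \<Rightarrow> real \<Rightarrow> real \<Rightarrow> real \<Rightarrow> real" where
  "mono_int i j r al be = integral {al..be} (\<lambda>t. (r * sin t) ^ i * (r * cos t) ^ j)"

lemma mono_int_has_integral:
  "((\<lambda>t. (r * sin t) ^ i * (r * cos t) ^ j) has_integral mono_int i j r al be) {al..be}"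
  unfolding mono_int_def
  by (intro integrable_integral integrable_continuous_real continuous_intros)

lemma mono_int_reduce_sin:
  "mono_int (Suc (Suc i)) j r al be = r\<^sup>2 * mono_int i j r al be - mono_int i (Suc (Suc j)) r al be"
proof -
  have *: "x ^ Suc (Suc i) * y ^ j = (x * x + y * y) * (x ^ i * y ^ j) - x ^ i * y ^ Suc (Suc j)"
    for x y :: real
    by (simp add: algebra_simps)
  have "(r * sin t) ^ Suc (Suc i) * (r * cos t) ^ j =
      r\<^sup>2 * ((r * sin t) ^ i * (r * cos t) ^ j) - (r * sin t) ^ i * (r * cos t) ^ Suc (Suc j)" for t
  proof -
    have "(r * sin t) * (r * sin t) + (r * cos t) * (r * cos t) = r\<^sup>2 * ((sin t)\<^sup>2 + (cos t)\<^sup>2)"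
      by (simp add: power2_eq_square distrib_left mult_ac del: sin_cos_squared_add)
    then show ?thesis unfolding * by simp
  qed
  then have "((\<lambda>t. (r * sin t) ^ Suc (Suc i) * (r * cos t) ^ j) has_integral
      r\<^sup>2 * mono_int i j r al be - mono_int i (Suc (Suc j)) r al be) {al..be}"
    using has_integral_diff[OF has_integral_mult_right[OF mono_int_has_integral[of r i j al be], of "r\<^sup>2"]
        mono_int_has_integral[of r i "Suc (Suc j)" al be]] by simp
  then show ?thesis using has_integral_unique mono_int_has_integral by blast
qed

lemma cos_power_has_deriv:
  "((\<lambda>t. (r * cos t) ^ Suc m) has_real_derivative
    - (real (Suc m) * ((r * sin t) * (r * cos t) ^ m))) (at t within S)"
proof (rule DERIV_cong[OF DERIV_power_Suc])
  show "((\<lambda>t. r * cos t) has_real_derivative - (r * sin t)) (at t within S)"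
    by (auto intro!: derivative_eq_intros)
qed simp

text \<open>Integration by parts: differentiate x y^(m+1) along x' = y, y' = -x and replace x^2 by
  r^2 - y^2.\<close>

lemma mono_int_reduce_cos:
  assumes "al \<le> be"
  shows "real (Suc (Suc m)) * mono_int 0 (Suc (Suc m)) r al be =
    (r * sin be) * (r * cos be) ^ Suc m - (r * sin al) * (r * cos al) ^ Suc m
     + real (Suc m) * (r\<^sup>2 * mono_int 0 m r al be)"
proof -
  have "((\<lambda>t. (r * sin t) * (r * cos t) ^ Suc m) has_real_derivative
      (r * cos t) ^ Suc (Suc m) - real (Suc m) * ((r * sin t)\<^sup>2 * (r * cos t) ^ m)) (at t within {al..be})" for t
  proof (rule DERIV_cong[OF DERIV_mult[OF _ cos_power_has_deriv]])
    show "((\<lambda>t. r * sin t) has_real_derivative r * cos t) (at t within {al..be})"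
      by (auto intro!: derivative_eq_intros)
  qed (simp add: power2_eq_square algebra_simps)
  moreover have "(r * cos t) ^ Suc (Suc m) - real (Suc m) * ((r * sin t)\<^sup>2 * (r * cos t) ^ m)
      = real (Suc (Suc m)) * (r * cos t) ^ Suc (Suc m) - real (Suc m) * (r\<^sup>2 * (r * cos t) ^ m)" for t
  proof -
    have "(r * sin t)\<^sup>2 = r\<^sup>2 - (r * cos t)\<^sup>2" by (simp add: power_mult_distrib sin_squared_eq algebra_simps)
    moreover have "y ^ Suc (Suc m) - k * ((a - y\<^sup>2) * y ^ m) = (1 + k) * y ^ Suc (Suc m) - k * (a * y ^ m)"
      for y k a :: real
      by (simp add: power2_eq_square algebra_simps)
    ultimately show ?thesis by (simp only: of_nat_Suc[of "Suc m"])
  qed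
  ultimately have "((\<lambda>t. real (Suc (Suc m)) * (r * cos t) ^ Suc (Suc m) - real (Suc m) * (r\<^sup>2 * (r * cos t) ^ m))
      has_integral (r * sin be) * (r * cos be) ^ Suc m - (r * sin al) * (r * cos al) ^ Suc m) {al..be}"
    by (intro fundamental_theorem_of_calculus assms)
      (simp add: has_real_derivative_iff_has_vector_derivative[symmetric])
  moreover have "((\<lambda>t. real (Suc (Suc m)) * (r * cos t) ^ Suc (Suc m) - real (Suc m) * (r\<^sup>2 * (r * cos t) ^ m))
      has_integral real (Suc (Suc m)) * mono_int 0 (Suc (Suc m)) r al be
        - real (Suc m) * (r\<^sup>2 * mono_int 0 m r al be)) {al..be}"
  proof -
    have "((\<lambda>t. (r * cos t) ^ j) has_integral mono_int 0 j r al be) {al..be}" for j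
      using mono_int_has_integral[of r 0 j al be] by simp
    then show ?thesis by (intro has_integral_diff has_integral_mult_right)
  qed
  ultimately have "(r * sin be) * (r * cos be) ^ Suc m - (r * sin al) * (r * cos al) ^ Suc m
      = real (Suc (Suc m)) * mono_int 0 (Suc (Suc m)) r al be - real (Suc m) * (r\<^sup>2 * mono_int 0 m r al be)"
    by (rule has_integral_unique)
  then show ?thesis by linarith
qed

text \<open>The integrand is exact with a primitive depending on y only, and both end points have
  the same height.\<close>

lemma mono_int_1:
  assumes "al \<le> be" "r * cos al = r * cos be"
  shows "mono_int (Suc 0) m r al be = 0"
proof -
  have "((\<lambda>t. - ((r * cos t) ^ Suc m / real (Suc m))) has_real_derivative
      (r * sin t) ^ Suc 0 * (r * cos t) ^ m) (at t within {al..be})" for t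
    by (rule DERIV_cong[OF DERIV_minus[OF DERIV_cdivide[OF cos_power_has_deriv]]])
      (simp del: of_nat_Suc)
  then have "((\<lambda>t. (r * sin t) ^ Suc 0 * (r * cos t) ^ m) has_integral
      - ((r * cos be) ^ Suc m / real (Suc m)) - - ((r * cos al) ^ Suc m / real (Suc m))) {al..be}"
    by (intro fundamental_theorem_of_calculus assms)
      (simp add: has_real_derivative_iff_has_vector_derivative[symmetric])
  then have "mono_int (Suc 0) m r al be =
      - ((r * cos be) ^ Suc m / real (Suc m)) - - ((r * cos al) ^ Suc m / real (Suc m))"
    by (rule has_integral_unique[OF mono_int_has_integral])
  then show ?thesis by (simp only: assms(2))
qed

lemma mono_int_0_0: "al \<le> be \<Longrightarrow> mono_int 0 0 r al be = be - al"
  by (simp add: mono_int_def)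

lemma mono_int_0_1:
  assumes "al \<le> be"
  shows "mono_int 0 (Suc 0) r al be = r * sin be - r * sin al"
proof -
  have "((\<lambda>t. (r * sin t) ^ 0 * (r * cos t) ^ Suc 0) has_integral r * sin be - r * sin al) {al..be}"
    by (intro fundamental_theorem_of_calculus assms)
      (auto intro!: derivative_eq_intros simp: has_real_derivative_iff_has_vector_derivative[symmetric])
  then show ?thesis using has_integral_unique mono_int_has_integral by blast
qed

lemma arc_int_poly2:
  "arc_int (poly2 n a) (poly2 n b) r al be =
    (\<Sum>i\<le>n. \<Sum>j\<le>n - i. b i j * mono_int i (Suc j) r al be + a i j * mono_int (Suc i) j r al be)"
proof -
  have "((\<lambda>t. \<Sum>i\<le>n. \<Sum>j\<le>n - i. b i j * ((r * sin t) ^ i * (r * cos t) ^ Suc j)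
        + a i j * ((r * sin t) ^ Suc i * (r * cos t) ^ j)) has_integral
      (\<Sum>i\<le>n. \<Sum>j\<le>n - i. b i j * mono_int i (Suc j) r al be + a i j * mono_int (Suc i) j r al be)) {al..be}"
    by (intro has_integral_sum has_integral_add has_integral_mult_right mono_int_has_integral) auto
  moreover have "poly2 n b (r * sin t) (r * cos t) * (r * cos t) + poly2 n a (r * sin t) (r * cos t) * (r * sin t)
      = (\<Sum>i\<le>n. \<Sum>j\<le>n - i. b i j * ((r * sin t) ^ i * (r * cos t) ^ Suc j)
        + a i j * ((r * sin t) ^ Suc i * (r * cos t) ^ j))" for t
    by (simp add: poly2_def sum_distrib_left sum.distrib mult_ac)
  ultimately show ?thesis
    unfolding arc_int_def by (simp only: integral_unique)
qed

text \<open>The end points of the arc, in this order, are \<open>(-\<sigma>u, \<tau>u\<^sup>2)\<close> and \<open>(\<sigma>u, \<tau>u\<^sup>2)\<close>.\<close>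

definition sym_arc :: "real \<Rightarrow> real \<Rightarrow> (real \<Rightarrow> real) \<Rightarrow> (real \<Rightarrow> real) \<Rightarrow> bool" where
  "sym_arc \<sigma> \<tau> al be \<longleftrightarrow> (\<exists>\<alpha> \<beta>. \<forall>h>0. be h - al h = \<alpha> + \<beta> * thA h) \<and>
    (\<forall>h>0. al h \<le> be h \<and> sqrt h * sin (be h) = \<sigma> * uu h \<and> sqrt h * sin (al h) = - \<sigma> * uu h \<and>
      sqrt h * cos (be h) = \<tau> * (uu h)\<^sup>2 \<and> sqrt h * cos (al h) = \<tau> * (uu h)\<^sup>2)"

lemma sym_arcD:
  assumes "sym_arc \<sigma> \<tau> al be" "0 < h"
  shows "al h \<le> be h" "sqrt h * sin (be h) = \<sigma> * uu h" "sqrt h * sin (al h) = - \<sigma> * uu h"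
    "sqrt h * cos (be h) = \<tau> * (uu h)\<^sup>2" "sqrt h * cos (al h) = \<tau> * (uu h)\<^sup>2"
  using assms unfolding sym_arc_def by blast+

text \<open>As the end points are mirror images in the y-axis, the boundary terms add up to 2
  \<sigma> \<tau>^(m+1) u w^(m+1); the even recursion ends in the arc length, the odd one in a
  multiple of u.\<close>

lemma hom_form_mono_int_cos:
  assumes arc: "sym_arc \<sigma> \<tau> al be"
  shows "hom_form j (\<lambda>h. mono_int 0 j (sqrt h) (al h) (be h))"
proof (induction j rule: induct_nat_012)
  case 0
  obtain \<alpha> \<beta> where ab: "\<forall>h>0. be h - al h = \<alpha> + \<beta> * thA h"
    using arc unfolding sym_arc_def by blast
  show ?case
    unfolding hom_form_def using ab sym_arcD(1)[OF arc]
    by (intro exI[of _ \<alpha>] exI[of _ \<beta>] exI[of _ 0]) (auto simp: mono_int_0_0)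
next
  case 1
  show ?case
    by (rule hom_form_cong[OF _ hom_form_uu[of 0 "2 * \<sigma>"]])
      (use sym_arcD[OF arc] in \<open>simp add: mono_int_0_1\<close>)
next
  case (ge2 m)
  have "hom_form (Suc (Suc m)) (\<lambda>h. (2 * \<sigma> * \<tau> ^ Suc m / real (Suc (Suc m))) * uu h * ((uu h)\<^sup>2) ^ Suc m
      + (real (Suc m) / real (Suc (Suc m))) * (h * mono_int 0 m (sqrt h) (al h) (be h)))"
    by (intro hom_form_add hom_form_uu hom_form_scale hom_form_mult ge2)
  then show ?case
  proof (rule hom_form_cong[rotated])
    fix h :: real assume h: "0 < h"
    have "real (Suc (Suc m)) * mono_int 0 (Suc (Suc m)) (sqrt h) (al h) (be h)
        = 2 * \<sigma> * uu h * (\<tau> ^ Suc m * ((uu h)\<^sup>2) ^ Suc m)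
          + real (Suc m) * (h * mono_int 0 m (sqrt h) (al h) (be h))"
      unfolding mono_int_reduce_cos[OF sym_arcD(1)[OF arc h]] sym_arcD(2-5)[OF arc h] power_mult_distrib
      using h by simp
    note E = this
    have "mono_int 0 (Suc (Suc m)) (sqrt h) (al h) (be h)
        = (2 * \<sigma> * uu h * (\<tau> ^ Suc m * ((uu h)\<^sup>2) ^ Suc m)
          + real (Suc m) * (h * mono_int 0 m (sqrt h) (al h) (be h))) / real (Suc (Suc m))"
      unfolding E[symmetric] by (simp del: of_nat_Suc)
    then show "2 * \<sigma> * \<tau> ^ Suc m / real (Suc (Suc m)) * uu h * ((uu h)\<^sup>2) ^ Suc m
        + real (Suc m) / real (Suc (Suc m)) * (h * mono_int 0 m (sqrt h) (al h) (be h))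
        = mono_int 0 (Suc (Suc m)) (sqrt h) (al h) (be h)"
      by (simp only: add_divide_distrib times_divide_eq_left times_divide_eq_right mult_ac)
  qed
qed

text \<open>Replacing x^2 by h - y^2 reduces the power of x to 0 or 1, where 1 gives zero.\<close>

lemma hom_form_mono_int:
  assumes arc: "sym_arc \<sigma> \<tau> al be"
  shows "hom_form (i + j) (\<lambda>h. mono_int i j (sqrt h) (al h) (be h))"
proof (induction i arbitrary: j rule: induct_nat_012)
  case 0
  then show ?case using hom_form_mono_int_cos[OF arc] by simp
next
  case 1
  have "hom_form (Suc 0 + j) (\<lambda>h. 0 * uu h * ((uu h)\<^sup>2) ^ j)" using hom_form_uu[of j 0] by simp
  then show ?case
    by (rule hom_form_cong[rotated]) (use sym_arcD[OF arc] in \<open>simp add: mono_int_1\<close>)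
next
  case (ge2 i)
  have "hom_form (Suc (Suc i) + j) (\<lambda>h. h * mono_int i j (sqrt h) (al h) (be h)
      + (-1) * mono_int i (Suc (Suc j)) (sqrt h) (al h) (be h))"
    using hom_form_mult[OF ge2(1)[of j]] ge2(1)[of "Suc (Suc j)"] by (intro hom_form_add hom_form_scale) simp_all
  then show ?case
    by (rule hom_form_cong[rotated]) (simp add: mono_int_reduce_sin)
qed

lemma mel_form_arc_int:
  assumes "sym_arc \<sigma> \<tau> al be"
  shows "mel_form n (\<lambda>h. arc_int (poly2 n a) (poly2 n b) (sqrt h) (al h) (be h))"
  unfolding arc_int_poly2
proof (intro mel_form_sum mel_form_add mel_form_scale)
  fix i j assume "i \<in> {..n}" "j \<in> {..n - i}"
  then show "mel_form n (\<lambda>h. mono_int i (Suc j) (sqrt h) (al h) (be h))"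
    and "mel_form n (\<lambda>h. mono_int (Suc i) j (sqrt h) (al h) (be h))"
    by (auto intro!: mel_form_of_hom_form[OF hom_form_mono_int[OF assms]])
qed auto

text \<open>Treats both curves at once: \<sigma> = \<tau> = 1 for \<open>Parab\<close> and -1 for
  \<open>NegParab\<close>. The arcs share their end points in opposite order, hence the sign of the
  first one.\<close>

lemma melnikov_arcs:
  obtains \<sigma> \<tau> al1 be1 al2 be2 where
    "sym_arc (- \<sigma>) \<tau> al1 be1" "sym_arc \<sigma> \<tau> al2 be2" "\<sigma> * \<tau> = 1" "\<sigma> * \<sigma> = 1"
    "\<And>h. (be1 h - al1 h) + (be2 h - al2 h) = 2 * pi"
    "\<And>n a1 b1 a2 b2 h. melnikov c n a1 b1 a2 b2 h =
       arc_int (poly2 n a1) (poly2 n b1) (sqrt h) (al1 h) (be1 h)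
       + arc_int (poly2 n a2) (poly2 n b2) (sqrt h) (al2 h) (be2 h)"
proof -
  have le: "0 \<le> thA h" "thA h \<le> pi" if "0 < h" for h
    using thA_bounds[OF that] by linarith+
  show thesis
  proof (cases c)
    case Parab
    show ?thesis
    proof (rule that[of "1" 1 thA "\<lambda>h. 2 * pi - thA h" "\<lambda>h. 2 * pi - thA h" "\<lambda>h. 2 * pi + thA h"])
      show "sym_arc (- 1) 1 thA (\<lambda>h. 2 * pi - thA h)"
        unfolding sym_arc_def
        by (rule conjI, rule exI[of _ "2 * pi"], rule exI[of _ "-2"]) (use sin_thA cos_thA le in \<open>auto simp: sin_diff cos_diff\<close>)
      show "sym_arc 1 1 (\<lambda>h. 2 * pi - thA h) (\<lambda>h. 2 * pi + thA h)"
        unfolding sym_arc_def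
        by (rule conjI, rule exI[of _ "0"], rule exI[of _ "2"]) (use sin_thA cos_thA le in \<open>auto simp: sin_diff cos_diff sin_add cos_add\<close>)
    qed (simp_all add: Parab melnikov_def Let_def)
  next
    case NegParab
    have s3: "sin (3 * pi - x) = sin x" "cos (3 * pi - x) = - cos x" for x
    proof -
      have "3 * pi - x = (pi - x) + 2 * pi" by simp
      then have "sin (3 * pi - x) = sin (pi - x)" "cos (3 * pi - x) = cos (pi - x)"
        by (simp_all only: sin_periodic cos_periodic)
      then show "sin (3 * pi - x) = sin x" "cos (3 * pi - x) = - cos x" by simp_all
    qed
    show ?thesis
    proof (rule that[of "-1" "-1" "\<lambda>h. pi + thA h" "\<lambda>h. 3 * pi - thA h" "\<lambda>h. pi - thA h" "\<lambda>h. pi + thA h"])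
      show "sym_arc (- (- 1)) (- 1) (\<lambda>h. pi + thA h) (\<lambda>h. 3 * pi - thA h)"
        unfolding sym_arc_def
        by (rule conjI, rule exI[of _ "2 * pi"], rule exI[of _ "-2"]) (use sin_thA cos_thA le in \<open>auto simp: s3 sin_add cos_add\<close>)
      show "sym_arc (- 1) (- 1) (\<lambda>h. pi - thA h) (\<lambda>h. pi + thA h)"
        unfolding sym_arc_def
        by (rule conjI, rule exI[of _ "0"], rule exI[of _ "2"]) (use sin_thA cos_thA le in \<open>auto simp: sin_add cos_add\<close>)
    qed (simp_all add: NegParab melnikov_def Let_def)
  qed
qed

section \<open>The upper bound and its sharpness for n = 1\<close>

lemma HH_le:
  assumes "1 \<le> n"
  shows "HH c n \<le> enat (n + 3 * ((n - 1) div 2) + 2)"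
  unfolding HH_def
proof (rule Sup_least, clarify)
  fix a1 b1 a2 b2 h
  assume "0 < (h :: real)" "melnikov c n a1 b1 a2 b2 h \<noteq> 0"
  moreover have "mel_form n (melnikov c n a1 b1 a2 b2)"
  proof -
    obtain \<sigma> \<tau> al1 be1 al2 be2 where
      arcs: "sym_arc (- \<sigma>) \<tau> al1 be1" "sym_arc \<sigma> \<tau> al2 be2" and
      M: "\<And>n a1 b1 a2 b2 h. melnikov c n a1 b1 a2 b2 h =
         arc_int (poly2 n a1) (poly2 n b1) (sqrt h) (al1 h) (be1 h)
         + arc_int (poly2 n a2) (poly2 n b2) (sqrt h) (al2 h) (be2 h)"
      by (rule melnikov_arcs[of c]) blast
    then show ?thesis
      using mel_form_add[OF mel_form_arc_int[OF arcs(1)] mel_form_arc_int[OF arcs(2)]]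
      by (intro mel_form_cong[OF M[symmetric]])
  qed
  ultimately show "num_zeros (melnikov c n a1 b1 a2 b2) \<le> enat (n + 3 * ((n - 1) div 2) + 2)"
    using assms by (intro num_zeros_mel_form) auto
qed

text \<open>With 1, 1/2, 1/3 as roots the quartic below has equal coefficients at \<open>u\<^sup>2\<close> and \<open>u\<^sup>4\<close>, so that
  it is a combination of \<open>h = u\<^sup>2 + u\<^sup>4\<close>, \<open>u\<^sup>3\<close> and \<open>u\<close>.\<close>

lemma melnikov_three_zeros:
  obtains a1 b1 a2 b2 where
    "\<And>h. 0 < h \<Longrightarrow> melnikov c 1 a1 b1 a2 b2 h = uu h * (uu h - 1) * (uu h - 1 / 2) * (uu h - 1 / 3)"
proof -
  obtain \<sigma> \<tau> al1 be1 al2 be2 where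
    arc1: "sym_arc (- \<sigma>) \<tau> al1 be1" and arc2: "sym_arc \<sigma> \<tau> al2 be2" and \<sigma>: "\<sigma> * \<tau> = 1" "\<sigma> * \<sigma> = 1"
    and len: "\<And>h. (be1 h - al1 h) + (be2 h - al2 h) = 2 * pi"
    and M: "\<And>n a1 b1 a2 b2 h. melnikov c n a1 b1 a2 b2 h =
       arc_int (poly2 n a1) (poly2 n b1) (sqrt h) (al1 h) (be1 h)
       + arc_int (poly2 n a2) (poly2 n b2) (sqrt h) (al2 h) (be2 h)"
    by (rule melnikov_arcs[of c]) blast
  \<comment> \<open>The target is h - 11/6 u^3 - u/6. The coefficients of y in g1, and of y in g2
    plus x in f2, are both 1/pi, so the arc lengths enter only through their sum; 11/12 in f2
    adjusts u^3, and the constant in g2 adjusts u.\<close>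
  define b1 where "b1 i j = (if i = 0 \<and> j = 1 then 1 / pi else 0)" for i j :: nat
  define a2 where "a2 i j = (if i = 1 \<and> j = 0 then 11 / 12 else 0 :: real)" for i j :: nat
  define b2 where "b2 i j = (if i = 0 \<and> j = 0 then - \<sigma> / 12
    else if i = 0 \<and> j = 1 then 1 / pi - 11 / 12 else 0)" for i j :: nat
  show thesis
  proof (rule that[of "\<lambda>_ _. 0" b1 a2 b2])
    fix h :: real assume h: "0 < h"
    define u where "u = uu h"
    define L1 where "L1 = be1 h - al1 h"
    define L2 where "L2 = be2 h - al2 h"
    have hu: "h = u\<^sup>2 * (1 + u\<^sup>2)" unfolding u_def by (rule uu_eq[OF h, symmetric])
    have cos2: "mono_int 0 (Suc (Suc 0)) (sqrt h) (al h) (be h) = (s * \<tau>) * (u * u\<^sup>2) + h * (be h - al h) / 2"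
      and cos1: "mono_int 0 (Suc 0) (sqrt h) (al h) (be h) = 2 * s * u"
      and sin2: "mono_int (Suc (Suc 0)) 0 (sqrt h) (al h) (be h) = h * (be h - al h) / 2 - (s * \<tau>) * (u * u\<^sup>2)"
      if "sym_arc s \<tau> al be" for s al be
    proof -
      note D = sym_arcD[OF that h]
      show c2: "mono_int 0 (Suc (Suc 0)) (sqrt h) (al h) (be h) = (s * \<tau>) * (u * u\<^sup>2) + h * (be h - al h) / 2"
      proof -
        have "2 * mono_int 0 (Suc (Suc 0)) (sqrt h) (al h) (be h) = 2 * ((s * \<tau>) * (u * u\<^sup>2)) + h * (be h - al h)"
          using mono_int_reduce_cos[OF D(1), of 0 "sqrt h"] h
          by (simp add: D(2-5) mono_int_0_0[OF D(1)] u_def mult_ac)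
        then show ?thesis by simp
      qed
      show "mono_int 0 (Suc 0) (sqrt h) (al h) (be h) = 2 * s * u"
        by (simp add: mono_int_0_1[OF D(1)] D(2,3) u_def)
      show "mono_int (Suc (Suc 0)) 0 (sqrt h) (al h) (be h) = h * (be h - al h) / 2 - (s * \<tau>) * (u * u\<^sup>2)"
        using h by (simp add: mono_int_reduce_sin c2 mono_int_0_0[OF D(1)] field_simps)
    qed
    have "melnikov c 1 (\<lambda>_ _. 0) b1 a2 b2 h
        = 1 / pi * (h * L1 / 2 - u * u\<^sup>2) + - \<sigma> / 12 * (2 * \<sigma> * u)
          + (1 / pi - 11 / 12) * (u * u\<^sup>2 + h * L2 / 2) + 11 / 12 * (h * L2 / 2 - u * u\<^sup>2)"
      unfolding M arc_int_poly2
      by (simp add: b1_def a2_def b2_def cos1[OF arc2] cos2[OF arc1] cos2[OF arc2] sin2[OF arc2]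
          \<sigma>(1) L1_def L2_def)
    also have "\<dots> = 1 / pi * (h * (L1 + L2) / 2) - 11 / 6 * (u * u\<^sup>2) - (\<sigma> * \<sigma>) * u / 6"
    proof -
      have "p * (h * L1 / 2 - k) + - \<sigma> / 12 * (2 * \<sigma> * u) + (p - 11 / 12) * (k + h * L2 / 2)
          + 11 / 12 * (h * L2 / 2 - k) = p * (h * (L1 + L2) / 2) - 11 / 6 * k - (\<sigma> * \<sigma>) * u / 6" for p k :: real
        by (simp add: field_simps)
      then show ?thesis .
    qed
    \<comment> \<open>The two arcs together make up the full circle, so \<theta> cancels.\<close>
    also have "\<dots> = h - 11 / 6 * (u * u\<^sup>2) - u / 6"
      using len[of h] by (simp add: L1_def L2_def \<sigma>(2))
    also have "\<dots> = u * (u - 1) * (u - 1 / 2) * (u - 1 / 3)"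
      unfolding hu by (simp add: power2_eq_square field_simps)
    finally show "melnikov c 1 (\<lambda>_ _. 0) b1 a2 b2 h
        = uu h * (uu h - 1) * (uu h - 1 / 2) * (uu h - 1 / 3)" by (simp only: u_def)
  qed
qed

lemma HH_1_ge: "3 \<le> HH c 1"
proof -
  obtain a1 b1 a2 b2 where M: "\<And>h. 0 < h \<Longrightarrow>
      melnikov c 1 a1 b1 a2 b2 h = uu h * (uu h - 1) * (uu h - 1 / 2) * (uu h - 1 / 3)"
    by (rule melnikov_three_zeros[of c]) blast
  \<comment> \<open>The arguments are v^2 (1 + v^2) for v = 1, 1/2, 1/3, the roots, and for v = 2,
    where the quartic does not vanish.\<close>
  have uu: "uu 2 = 1" "uu (5 / 16) = 1 / 2" "uu (10 / 81) = 1 / 3" "uu 20 = 2"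
    using uu_inverse[of 1] uu_inverse[of "1 / 2"] uu_inverse[of "1 / 3"] uu_inverse[of 2]
    by (simp_all add: power2_eq_square)
  have "enat (card {2, 5 / 16, 10 / 81 :: real}) \<le> num_zeros (melnikov c 1 a1 b1 a2 b2)"
  proof (rule num_zeros_ge_card)
    have "\<forall>x\<in>{2, 5 / 16, 10 / 81 :: real}. 0 < x \<and> melnikov c 1 a1 b1 a2 b2 x = 0"
      by (simp add: M uu del: One_nat_def)
    then show "0 < x \<and> melnikov c 1 a1 b1 a2 b2 x = 0" if "x \<in> {2, 5 / 16, 10 / 81}" for x
      using that by blast
  qed simp
  moreover have "\<exists>h>0. melnikov c 1 a1 b1 a2 b2 h \<noteq> 0"
    by (intro exI[of _ 20]) (simp add: M uu del: One_nat_def)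
  then have "num_zeros (melnikov c 1 a1 b1 a2 b2) \<le> HH c 1"
    unfolding HH_def by (intro Sup_upper) blast
  ultimately have "enat 3 \<le> HH c 1" by (simp add: numeral_3_eq_3)
  then show ?thesis by (simp add: numeral_eq_enat)
qed

theorem theorem1p2:
  fixes c :: curve
  shows "HH c 1 = 3 \<and>
         (\<forall>n\<ge>2. HH c n \<le> enat (2 * n + 5 * ((n - 1) div 2) + 4))"
proof (intro conjI allI impI)
  show "HH c 1 = 3"
    using HH_le[of 1 c] HH_1_ge[of c] by (simp add: numeral_eq_enat numeral_3_eq_3)
next
  fix n :: nat assume "2 \<le> n"
  then have "HH c n \<le> enat (n + 3 * ((n - 1) div 2) + 2)" by (intro HH_le) simp
  also have "\<dots> \<le> enat (2 * n + 5 * ((n - 1) div 2) + 4)" by simp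
  finally show "HH c n \<le> enat (2 * n + 5 * ((n - 1) div 2) + 4)" .
qed

end
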